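(* Let $(\mathcal{A},d',d'')$ be a totally bounded double complex of complex vector spaces. Assume that one of the cohomologies $H_{BC}(\mathcal{A})$, $H_A(\mathcal{A})$, $H_{d'}(\mathcal{A})$, $H_{d''}(\mathcal{A})$, $H_d(\mathcal{A})$ is finite dimensional. Then the following statements are equivalent: (1) $\mathcal{A}$ satisfies the $d'd''$-lemma; (2) $h^{p,q}_{BC}=h^{p,q}_{d'}=h^{p,q}_{d''}$ for all $p,q$; (3) $h^{p,q}_A=h^{p,q}_{d'}=h^{p,q}_{d''}$ for all $p,q$; (4) $h^k_{BC}=b^k$ for all $k$; (5) $h^k_A=b^k$ for all $k$.
   Context: A double complex is a bigraded complex vector space $\mathcal{A}=\bigoplus_{p,q\in\mathbb{Z}}\mathcal{A}^{p,q}$ with linear maps $d':\mathcal{A}^{p,q}\to\mathcal{A}^{p+1,q}$, $d'':\mathcal{A}^{p,q}\to\mathcal{A}^{p,q+1}$ such that $d'^2=d''^2=d'd''+d''d'=0$. Put $d=d'+d''$ and $\mathcal{A}^k=\bigoplus_{p+q=k}\mathcal{A}^{p,q}$. It is totally bounded if $\mathcal{A}^{p,q}=0$ for all but finitely many $(p,q)$. Cohomologies: $H^k(\mathcal{A})=\dfrac{\ker d\cap\mathcal{A}^k}{d\mathcal{A}^{k-1}}$ (whose totality over $k$ is $H_d$), $H^{p,q}_{d'}(\mathcal{A})=\dfrac{\ker d'\cap\mathcal{A}^{p,q}}{d'\mathcal{A}^{p-1,q}}$, $H^{p,q}_{d''}(\mathcal{A})=\dfrac{\ker d''\cap\mathcal{A}^{p,q}}{d''\mathcal{A}^{p,q-1}}$,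 $H^{p,q}_{BC}(\mathcal{A})=\dfrac{\ker d'\cap\ker d''\cap\mathcal{A}^{p,q}}{\mathrm{Im}\,d'd''\cap\mathcal{A}^{p,q}}$, $H^{p,q}_A(\mathcal{A})=\dfrac{\ker d'd''\cap\mathcal{A}^{p,q}}{(\mathrm{Im}\,d'+\mathrm{Im}\,d'')\cap\mathcal{A}^{p,q}}$. A cohomology $H_\sharp(\mathcal{A})$ written without degrees is the collection of the corresponding groups in all (bi)degrees; it is finite dimensional if all these groups are. Notation: $b^k=\dim_{\mathbb{C}}H^k(\mathcal{A})$, $h^{p,q}_\sharp=\dim_{\mathbb{C}}H^{p,q}_\sharp(\mathcal{A})$ and $h^k_\sharp=\sum_{p+q=k}h^{p,q}_\sharp$ for $\sharp=d',d'',BC,A$. $\mathcal{A}$ satisfies the $d'd''$-lemma at $(p,q)$ if $\mathrm{Im}\,d'\cap\ker d''\cap\mathcal{A}^{p,q}=\ker d'\cap\mathrm{Im}\,d''\cap\mathcal{A}^{p,q}=\mathrm{Im}\,d'd''\cap\mathcal{A}^{p,q}$, and satisfies the $d'd''$-lemma if this holds for all $(p,q)$. *)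

theory Defs
  imports
    "Jordan_Normal_Form.VS_Connect"
    "HOL-Library.Set_Algebras"
    "HOL-Library.Groups_Big_Fun"
    "HOL-Library.Extended_Nat"
begin

section \<open>Double complexes\<close>

text \<open>
  The underlying complex vector space is the whole type \<open>'a\<close>, with scalar multiplication
  \<open>scale\<close>; it is the internal direct sum of the subspaces \<open>A p q\<close>.  The families of maps
  \<open>A p q \<rightarrow> A (p + 1) q\<close> and \<open>A p q \<rightarrow> A p (q + 1)\<close> are given by their unique linear extensions
  \<open>d'\<close> and \<open>d''\<close> to the total space.
\<close>

locale double_complex = vector_space scale
  for scale :: "complex \<Rightarrow> 'a::ab_group_add \<Rightarrow> 'a" +
  fixes A :: "int \<Rightarrow> int \<Rightarrow> 'a set"
    and d' d'' :: "'a \<Rightarrow> 'a"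
  assumes subspace_A: "subspace (A p q)"
    and direct_sum:
      "\<exists>!f. (\<forall>p q. f (p, q) \<in> A p q) \<and> finite {i. f i \<noteq> 0} \<and> x = Sum_any f"
    and linear_d': "Vector_Spaces.linear scale scale d'"
    and linear_d'': "Vector_Spaces.linear scale scale d''"
    and d'_bidegree: "d' ` A p q \<subseteq> A (p + 1) q"
    and d''_bidegree: "d'' ` A p q \<subseteq> A p (q + 1)"
    and d'_d': "d' (d' x) = 0"
    and d''_d'': "d'' (d'' x) = 0"
    and d'_d'': "d' (d'' x) + d'' (d' x) = 0"

definition totally_bounded_complex :: "(int \<Rightarrow> int \<Rightarrow> 'a::zero set) \<Rightarrow> bool" where
  "totally_bounded_complex A \<longleftrightarrow> finite {(p, q). A p q \<noteq> {0}}"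

definition total_d :: "('a \<Rightarrow> 'a) \<Rightarrow> ('a \<Rightarrow> 'a) \<Rightarrow> 'a \<Rightarrow> 'a::plus" where
  "total_d d' d'' x = d' x + d'' x"

text \<open>The sum over \<open>p + q = k\<close> of the \<open>A p q\<close>; it is direct in a double complex.\<close>

definition total_part ::
    "(complex \<Rightarrow> 'a \<Rightarrow> 'a) \<Rightarrow> (int \<Rightarrow> int \<Rightarrow> 'a set) \<Rightarrow> int \<Rightarrow> 'a::ab_group_add set" where
  "total_part scale A k = Modules.module.span scale (\<Union>p. A p (k - p))"

section \<open>Quotient spaces and dimensions\<close>

text \<open>
  The quotient \<open>Z / B\<close> for subspaces \<open>B \<subseteq> Z\<close>; its elements are the cosets \<open>x + B\<close>, and addition
  of cosets is addition of sets.  The summand \<open>B\<close> in the scalar multiplication only matters for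
  \<open>c = 0\<close>, where \<open>scale 0 ` C = {0}\<close> is not a coset.  The record fields \<open>mult\<close> and \<open>one\<close> play no
  role in a module.
\<close>

definition quotient_space ::
    "(complex \<Rightarrow> 'a \<Rightarrow> 'a) \<Rightarrow> 'a set \<Rightarrow> 'a set \<Rightarrow> (complex, 'a::ab_group_add set) module" where
  "quotient_space scale Z B =
    \<lparr>carrier = (\<lambda>x. x +o B) ` Z, mult = undefined, one = undefined,
     zero = B, add = (+), smult = (\<lambda>c C. scale c ` C + B)\<rparr>"

lemma vectorspace_quotient_space:
  assumes "vector_space scale"
    and "Modules.module.subspace scale Z" "Modules.module.subspace scale B" "B \<subseteq> Z"
  shows "vectorspace class_ring (quotient_space scale Z B)"
proof -
  interpret vector_space scale by fact
  have B0: "0 \<in> B" and Badd: "\<And>x y. x \<in> B \<Longrightarrow> y \<in> B \<Longrightarrow> x + y \<in> B"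
    and Bs: "\<And>c x. x \<in> B \<Longrightarrow> scale c x \<in> B"
    using assms(3) by (auto simp: subspace_def)
  have Z0: "0 \<in> Z" and Zadd: "\<And>x y. x \<in> Z \<Longrightarrow> y \<in> Z \<Longrightarrow> x + y \<in> Z"
    and Zs: "\<And>c x. x \<in> Z \<Longrightarrow> scale c x \<in> Z"
    using assms(2) by (auto simp: subspace_def)
  have Zm: "- x \<in> Z" if "x \<in> Z" for x
    using Zs[OF that, of "- 1"] by simp
  let ?c = "\<lambda>x. x +o B"
  have BB: "B + B = B"
    using B0 Badd by (auto simp: set_plus_def) (metis add_0)
  have z: "?c 0 = B"
    by (auto simp: elt_set_plus_def)
  have a: "?c x + ?c y = ?c (x + y)" for x y
    by (simp add: set_plus_rearrange BB)
  have s: "scale c ` (?c x) + B = ?c (scale c x)" for c x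
  proof -
    have "scale c x + scale c b + b' \<in> ?c (scale c x)" if "b \<in> B" "b' \<in> B" for b b'
      using that Badd[OF Bs[OF that(1)] that(2), of c]
      by (auto simp: elt_set_plus_def add.assoc)
    moreover have "scale c x + b \<in> scale c ` (?c x) + B" if "b \<in> B" for b
      using that B0 by (force simp: elt_set_plus_def set_plus_def)
    ultimately show ?thesis
      by (auto simp: set_plus_def elt_set_plus_def scale_right_distrib)
  qed
  let ?Q = "quotient_space scale Z B"
  have sel: "carrier ?Q = ?c ` Z" "zero ?Q = B" "add ?Q = (+)"
    "smult ?Q = (\<lambda>c C. scale c ` C + B)"
    by (simp_all add: quotient_space_def)
  have ag: "abelian_group ?Q"
  proof (rule abelian_groupI)
    show "\<zero>\<^bsub>?Q\<^esub> \<in> carrier ?Q"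
      using imageI[OF Z0, of ?c] by (simp only: sel z)
  next
    fix C assume C: "C \<in> carrier ?Q"
    then obtain x where x: "x \<in> Z" "C = ?c x" by (auto simp: sel)
    then have "?c (- x) + C = B"
      by (simp add: a z)
    then show "\<exists>y\<in>carrier ?Q. y \<oplus>\<^bsub>?Q\<^esub> C = \<zero>\<^bsub>?Q\<^esub>"
      using x Zm by (auto simp: sel)
    show "\<zero>\<^bsub>?Q\<^esub> \<oplus>\<^bsub>?Q\<^esub> C = C"
      using a[of 0 x] x by (simp add: sel z)
  qed (auto simp: sel a Zadd ac_simps)
  have "Module.module class_ring ?Q"
  proof (rule Module.moduleI)
    show "cring (class_ring :: complex ring)"
      by (rule class_cring.is_cring)
    show "smult ?Q (c \<oplus>\<^bsub>class_ring\<^esub> e) C = smult ?Q c C \<oplus>\<^bsub>?Q\<^esub> smult ?Q e C"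
      if C: "C \<in> carrier ?Q" for c e C
    proof -
      obtain x where x: "C = ?c x" using C by (auto simp: sel)
      show ?thesis
        unfolding sel x s a by (simp add: s scale_left_distrib[symmetric] del: scale_left_distrib)
    qed
    show "smult ?Q (\<one>\<^bsub>class_ring\<^esub>) C = C" if "C \<in> carrier ?Q" for C
      using that s[of 1] by (auto simp: sel)
  qed (use ag in \<open>auto simp: sel a s Zs scale_right_distrib\<close>)
  then show ?thesis
    by (intro vectorspace.intro class_field.field_axioms)
qed

text \<open>The dimension in \<open>{0, 1, 2, \<dots>, \<infinity>}\<close>; the library's \<open>vectorspace.dim\<close> is meaningful only for
  finite-dimensional spaces.\<close>

definition edim :: "(complex, 'v) module \<Rightarrow> enat" where
  "edim V = (if vectorspace.fin_dim class_ring V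
    then enat (vectorspace.dim class_ring V) else \<infinity>)"

section \<open>Cohomologies\<close>

context
  fixes scale :: "complex \<Rightarrow> 'a::ab_group_add \<Rightarrow> 'a"
    and A :: "int \<Rightarrow> int \<Rightarrow> 'a set"
    and d' d'' :: "'a \<Rightarrow> 'a"
begin

definition H_d :: "int \<Rightarrow> (complex, 'a set) module" where
  "H_d k = quotient_space scale
    ({x. total_d d' d'' x = 0} \<inter> total_part scale A k)
    (total_d d' d'' ` total_part scale A (k - 1))"

definition H_d' :: "int \<Rightarrow> int \<Rightarrow> (complex, 'a set) module" where
  "H_d' p q = quotient_space scale ({x. d' x = 0} \<inter> A p q) (d' ` A (p - 1) q)"

definition H_d'' :: "int \<Rightarrow> int \<Rightarrow> (complex, 'a set) module" where
  "H_d'' p q = quotient_space scale ({x. d'' x = 0} \<inter> A p q) (d'' ` A p (q - 1))"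

definition H_BC :: "int \<Rightarrow> int \<Rightarrow> (complex, 'a set) module" where
  "H_BC p q = quotient_space scale
    ({x. d' x = 0} \<inter> {x. d'' x = 0} \<inter> A p q) (range (d' \<circ> d'') \<inter> A p q)"

definition H_A :: "int \<Rightarrow> int \<Rightarrow> (complex, 'a set) module" where
  "H_A p q = quotient_space scale
    ({x. (d' \<circ> d'') x = 0} \<inter> A p q) ((range d' + range d'') \<inter> A p q)"

definition betti :: "int \<Rightarrow> enat" where "betti k = edim (H_d k)"
definition h_d' :: "int \<Rightarrow> int \<Rightarrow> enat" where "h_d' p q = edim (H_d' p q)"
definition h_d'' :: "int \<Rightarrow> int \<Rightarrow> enat" where "h_d'' p q = edim (H_d'' p q)"
definition h_BC :: "int \<Rightarrow> int \<Rightarrow> enat" where "h_BC p q = edim (H_BC p q)"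
definition h_A :: "int \<Rightarrow> int \<Rightarrow> enat" where "h_A p q = edim (H_A p q)"

end

text \<open>\<open>h\<^sup>k = (\<Sum>p+q=k. h\<^sup>p\<^sup>,\<^sup>q)\<close>.  \<open>Sum_any\<close> sums over the support, which is finite for the
  Hodge numbers of a totally bounded double complex (it would be \<open>0\<close> for an infinite support).\<close>

definition total_dim :: "(int \<Rightarrow> int \<Rightarrow> enat) \<Rightarrow> int \<Rightarrow> enat" where
  "total_dim h k = Sum_any (\<lambda>p. h p (k - p))"

section \<open>The \<open>d'd''\<close>-lemma\<close>

definition dd_lemma_at ::
    "(int \<Rightarrow> int \<Rightarrow> 'a set) \<Rightarrow> ('a \<Rightarrow> 'a) \<Rightarrow> ('a \<Rightarrow> 'a::zero) \<Rightarrow> int \<Rightarrow> int \<Rightarrow> bool" where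
  "dd_lemma_at A d' d'' p q \<longleftrightarrow>
    range d' \<inter> {x. d'' x = 0} \<inter> A p q = {x. d' x = 0} \<inter> range d'' \<inter> A p q \<and>
    {x. d' x = 0} \<inter> range d'' \<inter> A p q = range (d' \<circ> d'') \<inter> A p q"

definition dd_lemma ::
    "(int \<Rightarrow> int \<Rightarrow> 'a set) \<Rightarrow> ('a \<Rightarrow> 'a) \<Rightarrow> ('a \<Rightarrow> 'a::zero) \<Rightarrow> bool" where
  "dd_lemma A d' d'' \<longleftrightarrow> (\<forall>p q. dd_lemma_at A d' d'' p q)"

end

theory Submission
  imports Defs
begin

text \<open>
  The identity of the complex induces maps from Bott--Chern cohomology to \<open>H\<^sub>d'\<close>, \<open>H\<^sub>d''\<close> and \<open>H\<^sub>d\<close>,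
  and from these to Aeppli cohomology.  In total degree \<open>k\<close>, the \<open>d'd''\<close>-lemma is equivalent to
  injectivity of \<open>H\<^sub>B\<^sub>C \<rightarrow> H\<^sub>d\<close>, while the \<open>d'd''\<close>-lemma in degree \<open>k + 1\<close> gives surjectivity of that map
  in degree \<open>k\<close>; when the dimensions agree and are finite, surjectivity implies injectivity, so the
  \<open>d'd''\<close>-lemma propagates downwards from the degrees where the complex vanishes.  Dually, for
  \<open>H\<^sub>d \<rightarrow> H\<^sub>A\<close> it propagates upwards, and the same argument works bidegree by bidegree for \<open>H\<^sub>d'\<close> and
  \<open>H\<^sub>d''\<close>.

  Each of the finiteness assumptions implies that \<open>H\<^sub>d\<close> is finite dimensional.  Conversely, if \<open>H\<^sub>d\<close> is
  finite dimensional, then finiteness of \<open>H\<^sub>d'\<close> and \<open>H\<^sub>d''\<close> in degree \<open>k - 1\<close> implies that of \<open>H\<^sub>B\<^sub>C\<close> in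
  degree \<open>k\<close>, and finiteness of them in degree \<open>k\<close> implies that of \<open>H\<^sub>A\<close> in degree \<open>k - 1\<close>; so the
  equalities of Hodge numbers in (2) and (3) force these numbers to be finite, by induction on the
  degree.
\<close>

section \<open>Relative dimension\<close>

text \<open>No map between quotients is ever formed. For \<open>Z1 \<subseteq> Z2\<close> and
  \<open>B1 \<subseteq> B2\<close>, surjectivity of \<open>Z1/B1 \<rightarrow> Z2/B2\<close> is the
  inclusion \<open>Z2 \<subseteq> Z1 + B2\<close> and injectivity is
  \<open>Z1 \<inter> B2 \<subseteq> B1\<close>; every comparison map is handled through such
  inclusions. The obstacle is cancellation in \<open>enat\<close>, which requires a finite
  dimension. Finite Betti numbers settle the conditions in total degree but do not bound the Hodge
  numbers: for an isomorphism d' from A^{0,0} to A^{1,0} between infinite dimensional spaces, with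
  d'' = 0 and all other terms zero, H_d and H_d' vanish whereas H_d'', H_BC and H_A are infinite
  dimensional. So finiteness of the Hodge numbers has to be extracted from the asserted equalities,
  and the equality of h_d' and h_d'' is essential there: the staircases that bound H_BC and H_A run
  in both directions. Only one of two symmetric halves is argued each time; the other is the same
  result for the complex with bidegrees and differentials interchanged.\<close>

lemma enat_eq_add_self: "m = n + m \<Longrightarrow> m \<noteq> \<infinity> \<Longrightarrow> n = (0::enat)"
  by (cases m; cases n) (auto simp: zero_enat_def)

locale complex_vector_space = vector_space scale
  for scale :: "complex \<Rightarrow> 'a::ab_group_add \<Rightarrow> 'a"
begin

lemma span_Un_eq: "span (S \<union> T) = span S + span T"
  unfolding span_Un set_plus_def by blast

lemma subspace_set_plus: "subspace S \<Longrightarrow> subspace T \<Longrightarrow> subspace (S + T)"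
  using subspace_span[of "S \<union> T"] by (metis span_Un_eq span_eq_iff)

lemma set_plus_absorb: "subspace Z \<Longrightarrow> subspace B \<Longrightarrow> B \<subseteq> Z \<Longrightarrow> Z + B = Z"
  by (metis Un_absorb2 span_Un_eq span_eq_iff)

lemma set_plus_subset: "subspace W \<Longrightarrow> S \<subseteq> W \<Longrightarrow> T \<subseteq> W \<Longrightarrow> S + T \<subseteq> W"
  by (auto simp: set_plus_def intro!: subspace_add)

lemma span_Int_span_disjoint:
  assumes "independent C" "F \<subseteq> C" "G \<subseteq> C" "F \<inter> G = {}"
  shows "span F \<inter> span G = {0}"
proof -
  have "x = 0" if x: "x \<in> span F" "x \<in> span G" for x
  proof -
    have xC: "x \<in> span C" using x(1) assms(2) span_mono by blast
    have "representation C x v = 0" for v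
    proof (cases "v \<in> F")
      case True
      then have "representation G x v = 0" using representation_ne_zero[of G x v] assms(4) by blast
      then show ?thesis by (simp add: representation_extend[OF assms(1) x(2) assms(3)])
    next
      case False
      then have "representation F x v = 0" using representation_ne_zero[of F x v] by blast
      then show ?thesis by (simp add: representation_extend[OF assms(1) x(1) assms(2)])
    qed
    then show ?thesis using sum_nonzero_representation_eq[OF assms(1) xC] by simp
  qed
  then show ?thesis by (auto simp: span_zero)
qed

text \<open>\<open>F\<close> is a basis of a complement of \<open>B\<close> in \<open>Z\<close>, in
  other words a set of representatives of a basis of \<open>Z/B\<close>.\<close>

definition relative_basis :: "'a set \<Rightarrow> 'a set \<Rightarrow> 'a set \<Rightarrow> bool" where
  "relative_basis Z B F \<longleftrightarrow> independent F \<and> span F \<inter> B = {0} \<and> span F + B = Z"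

lemma relative_basis_exists:
  assumes "subspace Z" "subspace B" "B \<subseteq> Z"
  obtains F where "relative_basis Z B F"
proof -
  obtain b where b: "b \<subseteq> B" "independent b" "B \<subseteq> span b"
    using maximal_independent_subset by blast
  then obtain c where c: "b \<subseteq> c" "c \<subseteq> Z" "independent c" "Z \<subseteq> span c"
    using maximal_independent_subset_extend[OF order_trans[OF b(1) assms(3)] b(2)] by metis
  have B: "span b = B" and Z: "span c = Z"
    by (rule span_subspace[OF b(1,3) assms(2)], rule span_subspace[OF c(2,4) assms(1)])
  have "relative_basis Z B (c - b)"
    unfolding relative_basis_def
  proof (intro conjI)
    show "independent (c - b)" using c(3) by (rule independent_mono) blast
    show "span (c - b) \<inter> B = {0}"
      using span_Int_span_disjoint[of c "c - b" b] c by (simp add: B Diff_disjoint inf_commute)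
    have "c - b \<union> b = c" using c(1) by blast
    then show "span (c - b) + B = Z" using span_Un_eq[of "c - b" b] by (simp only: B Z)
  qed
  then show ?thesis by (rule that)
qed

lemma relative_basis_subset: "relative_basis Z B F \<Longrightarrow> subspace B \<Longrightarrow> F \<subseteq> Z"
  unfolding relative_basis_def
  by (metis add.right_neutral set_plus_intro span_superset subset_iff subspace_0)

lemma coset_eq_iff:
  assumes "subspace B"
  shows "x +o B = y +o B \<longleftrightarrow> x - y \<in> B"
proof
  assume "x +o B = y +o B"
  then have "x \<in> y +o B"
    using subspace_0[OF assms] set_plus_intro2[of 0 B x] by simp
  then show "x - y \<in> B" by (auto simp: elt_set_plus_def)
next
  assume *: "x - y \<in> B"
  have "x + b \<in> y +o B" if "b \<in> B" for b
    using subspace_add[OF assms * that] by (auto simp: elt_set_plus_def intro!: bexI[of _ "x - y + b"])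
  moreover have "y + b \<in> x +o B" if "b \<in> B" for b
    using subspace_diff[OF assms that *] by (auto simp: elt_set_plus_def intro!: bexI[of _ "b - (x - y)"])
  ultimately show "x +o B = y +o B"
    unfolding elt_set_plus_def[of x] elt_set_plus_def[of y] by (auto simp: elt_set_plus_def)
qed

text \<open>The bridge from the carrier-based dimension of the quotient module to the cardinality of
  a set of vectors: the cosets of a relative basis form a basis of the quotient. Later dimension
  counts are bookkeeping of relative bases.\<close>

lemma edim_quotient_space:
  assumes Z: "subspace Z" and B: "subspace B" and BZ: "B \<subseteq> Z" and F: "relative_basis Z B F"
  shows "edim (quotient_space scale Z B) = (if finite F then enat (card F) else \<infinity>)"
proof -
  let ?V = "quotient_space scale Z B"
  let ?c = "\<lambda>x. x +o B"
  interpret V: vectorspace "class_ring :: complex ring" ?V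
    by (rule vectorspace_quotient_space[OF _ Z B BZ]) unfold_locales
  have FZ: "F \<subseteq> Z" and iF: "independent F" and FB: "span F \<inter> B = {0}" and FBZ: "span F + B = Z"
    using F relative_basis_subset[OF F B] by (auto simp: relative_basis_def)
  have sel: "carrier ?V = ?c ` Z" "zero ?V = B" "add ?V = (+)"
    "smult ?V = (\<lambda>c C. scale c ` C + B)"
    by (simp_all add: quotient_space_def)
  have z: "?c 0 = B"
    by (auto simp: elt_set_plus_def)
  have BB: "B + B = B"
    using subspace_0[OF B] subspace_add[OF B] by (auto simp: set_plus_def) (metis add_0)
  have a: "?c x + ?c y = ?c (x + y)" for x y
    by (simp add: set_plus_rearrange BB)
  have s: "smult ?V k (?c x) = ?c (scale k x)" for k x
  proof -
    have "scale k ` B + B = B"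
      using subspace_0[OF B] subspace_add[OF B] subspace_scale[OF B]
      by (auto simp: set_plus_def) (metis add_0 scale_zero_right)
    moreover have "scale k ` (?c x) = scale k x +o (scale k ` B)"
      by (force simp: elt_set_plus_def image_iff scale_right_distrib)
    ultimately show ?thesis by (simp add: sel set_plus_rearrange3)
  qed
  have inj: "inj_on ?c F"
  proof (rule inj_onI)
    fix x y assume "x \<in> F" "y \<in> F" "?c x = ?c y"
    then have "x - y \<in> span F \<inter> B"
      by (simp add: coset_eq_iff[OF B] span_diff span_base)
    then show "x = y" using FB by simp
  qed
  \<comment> \<open>Linear combinations in the module run over sets of cosets, with coefficients
    indexed by cosets; injectivity on \<open>F\<close> keeps distinct vectors from merging.\<close>
  have lc: "V.lincomb u (?c ` S) = ?c (\<Sum>x\<in>S. scale (u (?c x)) x)"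
    if "finite S" "S \<subseteq> F" for u S
    using that
  proof (induction S)
    case empty
    then show ?case by (simp add: V.lincomb_def z) (simp add: sel)
  next
    case (insert x S)
    have "?c x \<notin> ?c ` S" using insert inj by (auto simp: inj_on_def)
    moreover have "?c ` S \<subseteq> carrier ?V" "?c x \<in> carrier ?V" using insert FZ by (auto simp: sel)
    ultimately have "V.lincomb u (insert (?c x) (?c ` S)) =
        smult ?V (u (?c x)) (?c x) + V.lincomb u (?c ` S)"
      using insert.hyps unfolding V.lincomb_def
      by (subst V.finsum_insert) (auto simp: sel(3) intro!: V.smult_closed)
    then show ?case using insert by (simp add: s a)
  qed
  have li: "V.lin_indpt (?c ` F)"
  proof
    assume "V.lin_dep (?c ` F)"
    then obtain T u v where T: "finite T" "T \<subseteq> ?c ` F" "V.lincomb u T = \<zero>\<^bsub>?V\<^esub>" "v \<in> T" "u v \<noteq> 0"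
      by (auto simp: V.lin_dep_def)
    obtain S where S: "S \<subseteq> F" "finite S" "T = ?c ` S"
      using finite_subset_image[OF T(1,2)] by blast
    let ?x = "\<Sum>x\<in>S. scale (u (?c x)) x"
    have "?c ?x = ?c 0" using lc[OF S(2,1)] T(3) S by (simp add: sel z)
    then have "?x - 0 \<in> B" by (simp only: coset_eq_iff[OF B])
    then have "?x \<in> B" by simp
    moreover have "?x \<in> span F" using S by (intro span_sum span_scale) (auto intro: span_base)
    ultimately have "?x = 0" using FB by auto
    then have "u (?c x) = 0" if "x \<in> S" for x
      using independentD[OF iF S(2,1), of "\<lambda>x. u (?c x)"] that by blast
    then show False using T S by auto
  qed
  have gen: "V.gen_set (?c ` F)"
  proof
    show "V.span (?c ` F) \<subseteq> carrier ?V"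
      using FZ by (intro V.span_is_subset2) (auto simp: sel)
    show "carrier ?V \<subseteq> V.span (?c ` F)"
    proof
      fix C assume "C \<in> carrier ?V"
      then obtain x where x: "x \<in> Z" "C = ?c x" by (auto simp: sel)
      then obtain y b where yb: "y \<in> span F" "b \<in> B" "x = y + b"
        using FBZ by (auto elim: set_plus_elim)
      then obtain S r where S: "finite S" "S \<subseteq> F" "y = (\<Sum>a\<in>S. scale (r a) a)"
        by (auto simp: span_explicit)
      \<comment> \<open>The coefficient of a coset is that of its unique representative in
        \<open>F\<close>.\<close>
      let ?u = "\<lambda>C. r (the_inv_into F ?c C)"
      have "(\<Sum>x\<in>S. scale (?u (?c x)) x) = y"
        unfolding S(3) using S by (intro sum.cong) (auto simp: the_inv_into_f_f[OF inj])
      moreover have "?c y = C"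
        unfolding x(2) coset_eq_iff[OF B] yb(3) using subspace_neg[OF B yb(2)] by simp
      ultimately have "C = V.lincomb ?u (?c ` S)"
        by (simp only: lc[OF S(1,2), of ?u])
      then show "C \<in> V.span (?c ` F)"
        unfolding V.span_def using S(1,2) by (intro CollectI exI[of _ ?u] exI[of _ "?c ` S"]) auto
    qed
  qed
  have carr: "?c ` F \<subseteq> carrier ?V" using FZ by (auto simp: sel)
  show ?thesis
  proof (cases "finite F")
    case True
    then have "V.fin_dim" using gen carr by (auto simp: V.fin_dim_def)
    moreover have "V.dim = card (?c ` F)"
      using True li gen carr by (intro V.dim_basis) (auto simp: V.basis_def)
    ultimately show ?thesis using True by (simp add: edim_def card_image[OF inj])
  next
    case False
    then have "\<not> V.fin_dim"
      using V.fin_dim_li_fin[OF _ li carr] finite_imageD[OF _ inj] by blast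
    then show ?thesis using False by (simp add: edim_def)
  qed
qed

abbreviation qdim :: "'a set \<Rightarrow> 'a set \<Rightarrow> enat" where
  "qdim Z B \<equiv> edim (quotient_space scale Z B)"

section \<open>Additivity of quotient dimensions\<close>

lemma independent_Un:
  assumes F: "independent F" and G: "independent G" and FG: "span F \<inter> span G = {0}"
  shows "independent (F \<union> G)"
proof
  assume "dependent (F \<union> G)"
  then obtain t u v where t: "finite t" "t \<subseteq> F \<union> G" "(\<Sum>v\<in>t. scale (u v) v) = 0" "v \<in> t" "u v \<noteq> 0"
    by (auto simp: dependent_explicit)
  have sum: "(\<Sum>v\<in>t \<inter> F. scale (u v) v) + (\<Sum>v\<in>t - F. scale (u v) v) = 0"
    using t(3) sum.Int_Diff[OF t(1), of "\<lambda>v. scale (u v) v" F] by simp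
  have 1: "(\<Sum>v\<in>t \<inter> F. scale (u v) v) \<in> span F"
    by (intro span_sum span_scale) (auto intro: span_base)
  have 2: "(\<Sum>v\<in>t - F. scale (u v) v) \<in> span G"
    using t(2) by (intro span_sum span_scale) (auto intro: span_base)
  have "(\<Sum>v\<in>t \<inter> F. scale (u v) v) \<in> span G"
    using sum span_neg[OF 2] by (simp add: eq_neg_iff_add_eq_0[symmetric])
  then have 3: "(\<Sum>v\<in>t \<inter> F. scale (u v) v) = 0" using 1 FG by blast
  then have 4: "(\<Sum>v\<in>t - F. scale (u v) v) = 0" using sum by simp
  have "u v = 0"
    using independentD[OF F, of "t \<inter> F"] independentD[OF G, of "t - F"] 3 4 t by blast
  then show False using t by simp
qed

text \<open>If \<open>f + g\<close> lies in \<open>B\<close> with \<open>f\<close> in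
  \<open>span F\<close> and \<open>g\<close> in \<open>span G\<close>, then \<open>g\<close> also
  lies in \<open>Y\<close>, so \<open>g = 0\<close> and then \<open>f = 0\<close>. Complements thus
  add up along \<open>B \<subseteq> Y \<subseteq> Z\<close>; disjointness makes their cardinalities
  add.\<close>

lemma relative_basis_trans:
  assumes B: "subspace B" and Y: "subspace Y" and "B \<subseteq> Y"
    and F: "relative_basis Y B F" and G: "relative_basis Z Y G"
  shows "relative_basis Z B (F \<union> G)" "F \<inter> G = {}"
proof -
  have FY: "F \<subseteq> Y" using relative_basis_subset[OF F B] .
  have sFY: "span F \<subseteq> Y" by (rule span_minimal[OF FY Y])
  have FG: "span F \<inter> span G = {0}"
    using G sFY span_zero by (auto simp: relative_basis_def)
  show "F \<inter> G = {}"
  proof (rule ccontr)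
    assume "F \<inter> G \<noteq> {}"
    then obtain x where x: "x \<in> F" "x \<in> G" by blast
    then have "x = 0" using FG span_base by blast
    then show False using x(1) F dependent_zero unfolding relative_basis_def by metis
  qed
  have "span (F \<union> G) + B = span G + (span F + B)"
    by (simp add: span_Un_eq add_ac)
  then have "span (F \<union> G) + B = Z"
    using F G by (simp only: relative_basis_def)
  moreover have "x = 0" if x: "x \<in> span (F \<union> G)" "x \<in> B" for x
  proof -
    obtain f g where fg: "x = f + g" "f \<in> span F" "g \<in> span G"
      using x(1) by (auto simp: span_Un_eq elim: set_plus_elim)
    have "g \<in> Y" using fg sFY x(2) assms(3) subspace_diff[OF Y, of x f] by auto
    then have "g = 0" using fg G by (auto simp: relative_basis_def)
    then show ?thesis using fg F x by (auto simp: relative_basis_def)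
  qed
  ultimately show "relative_basis Z B (F \<union> G)"
    using independent_Un[OF _ _ FG] F G subspace_0[OF B] span_zero by (auto simp: relative_basis_def)
qed

lemma qdim_add:
  assumes "subspace Z" "subspace Y" "subspace B" "B \<subseteq> Y" "Y \<subseteq> Z"
  shows "qdim Z B = qdim Z Y + qdim Y B"
proof -
  obtain F where F: "relative_basis Y B F" using relative_basis_exists assms by blast
  obtain G where G: "relative_basis Z Y G" using relative_basis_exists assms by blast
  note FG = relative_basis_trans[OF assms(3,2,4) F G]
  show ?thesis
    using assms FG(2) edim_quotient_space[OF _ _ _ F] edim_quotient_space[OF _ _ _ G]
      edim_quotient_space[OF _ _ _ FG(1)]
    by (auto simp: card_Un_disjoint)
qed

text \<open>A complement of \<open>X \<inter> Y\<close> in \<open>X\<close> is also a complement of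
  \<open>Y\<close> in \<open>X + Y\<close>, so a single \<open>F\<close> computes both
  dimensions.\<close>

lemma qdim_second_iso:
  assumes X: "subspace X" and Y: "subspace Y"
  shows "qdim (X + Y) Y = qdim X (X \<inter> Y)"
proof -
  have XY: "subspace (X \<inter> Y)" using X Y by (rule subspace_inter)
  obtain F where F: "relative_basis X (X \<inter> Y) F" using relative_basis_exists[OF X XY] by blast
  have "F \<subseteq> X" using relative_basis_subset[OF F XY] .
  then have "span F \<subseteq> X" using X by (rule span_minimal)
  moreover have "X \<inter> Y + Y = Y"
    using subspace_0[OF X] subspace_0[OF Y] subspace_add[OF Y] by (force simp: set_plus_def)
  ultimately have F': "relative_basis (X + Y) Y F"
    using F unfolding relative_basis_def by (metis Int_absorb2 add.assoc inf_assoc)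
  have "Y \<subseteq> X + Y" using subspace_0[OF X] by (force simp: set_plus_def)
  then show ?thesis
    using edim_quotient_space[OF X XY _ F] edim_quotient_space[OF _ Y _ F'] subspace_set_plus[OF X Y]
    by simp
qed

lemma qdim_eq_0_iff:
  assumes "subspace Z" "subspace B" "B \<subseteq> Z"
  shows "qdim Z B = 0 \<longleftrightarrow> Z = B"
proof -
  obtain F where F: "relative_basis Z B F" using relative_basis_exists assms by blast
  have "F = {} \<longleftrightarrow> Z = B"
  proof
    assume "F = {}"
    then show "Z = B" using F by (simp add: relative_basis_def)
  next
    assume "Z = B"
    then have "F \<subseteq> span F \<inter> B"
      using relative_basis_subset[OF F assms(2)] span_superset[of F] by blast
    then have "F \<subseteq> {0}" using F by (simp only: relative_basis_def)
    moreover have "0 \<notin> F" using F dependent_zero[of F] unfolding relative_basis_def by metis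
    ultimately show "F = {}" by blast
  qed
  then show ?thesis using edim_quotient_space[OF assms F] by (auto simp: zero_enat_def)
qed

text \<open>The chain \<open>B + B' \<subseteq> B + Z' \<subseteq> Z + Z'\<close> splits the
  dimension; the second isomorphism theorem identifies its two quotients with \<open>Z'/B'\<close>
  and \<open>Z/B\<close>.\<close>

lemma qdim_direct_sum:
  assumes Z: "subspace Z" and B: "subspace B" "B \<subseteq> Z"
    and Z': "subspace Z'" and B': "subspace B'" "B' \<subseteq> Z'"
    and dir: "Z \<inter> Z' = {0}"
  shows "qdim (Z + Z') (B + B') = qdim Z B + qdim Z' B'"
proof -
  have 1: "Z + (B + Z') = Z + Z'" and 2: "Z' + (B + B') = B + Z'"
    using set_plus_absorb[OF Z B] set_plus_absorb[OF Z' B'] by (metis add.assoc, metis add.left_commute)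
  have 3: "Z \<inter> (B + Z') = B"
  proof
    show "Z \<inter> (B + Z') \<subseteq> B"
    proof
      fix x assume "x \<in> Z \<inter> (B + Z')"
      then obtain b z where x: "x \<in> Z" "x = b + z" "b \<in> B" "z \<in> Z'" by (auto elim: set_plus_elim)
      then have "z \<in> Z" using subspace_diff[OF Z, of x b] B by auto
      then have "z = 0" using x(4) dir by blast
      then show "x \<in> B" using x by simp
    qed
    show "B \<subseteq> Z \<inter> (B + Z')" using B subspace_0[OF Z'] by (force simp: set_plus_def)
  qed
  have 4: "Z' \<inter> (B + B') = B'"
  proof
    show "Z' \<inter> (B + B') \<subseteq> B'"
    proof
      fix x assume "x \<in> Z' \<inter> (B + B')"
      then obtain b z where x: "x \<in> Z'" "x = b + z" "b \<in> B" "z \<in> B'" by (auto elim: set_plus_elim)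
      then have "b \<in> Z'" using subspace_diff[OF Z', of x z] B' by auto
      then have "b = 0" using x(3) dir B by blast
      then show "x \<in> B'" using x by simp
    qed
    show "B' \<subseteq> Z' \<inter> (B + B')" using B' subspace_0[OF B(1)] by (force simp: set_plus_def)
  qed
  have "qdim (Z + Z') (B + B') = qdim (Z + Z') (B + Z') + qdim (B + Z') (B + B')"
    using assms by (intro qdim_add subspace_set_plus set_plus_mono2) auto
  moreover have "qdim (Z + Z') (B + Z') = qdim Z B"
    using qdim_second_iso[OF Z subspace_set_plus[OF B(1) Z']] 1 3 by simp
  moreover have "qdim (B + Z') (B + B') = qdim Z' B'"
    using qdim_second_iso[OF Z' subspace_set_plus[OF B(1) B'(1)]] 2 4 by simp
  ultimately show ?thesis by simp
qed

lemma subspace_sum_sets: "(\<And>p. p \<in> P \<Longrightarrow> subspace (Z p)) \<Longrightarrow> subspace (sum Z P)"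
  by (induction P rule: infinite_finite_induct) (auto intro: subspace_set_plus)

lemma sum_sets_subset:
  assumes "subspace W" "\<And>p. p \<in> P \<Longrightarrow> S p \<subseteq> W"
  shows "sum S P \<subseteq> W"
  using assms(2)
proof (induction P rule: infinite_finite_induct)
  case (insert p P)
  then show ?case by (simp, intro set_plus_subset[OF assms(1)]) auto
qed (simp_all add: subspace_0[OF assms(1)])

lemma sum_sets_mono:
  fixes B Z :: "'i \<Rightarrow> 'a set"
  assumes "finite P" "\<And>p. p \<in> P \<Longrightarrow> B p \<subseteq> Z p"
  shows "sum B P \<subseteq> sum Z P"
  using assms by (induction P) (simp_all add: set_plus_mono2)

text \<open>Directness is stated against every \<open>Q \<subseteq> P\<close> omitting
  \<open>p\<close>, a form that subfamilies inherit and that therefore survives the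
  induction.\<close>

lemma qdim_direct_sum_family:
  assumes "finite P" and "\<And>p. p \<in> P \<Longrightarrow> subspace (Z p)" and "\<And>p. p \<in> P \<Longrightarrow> subspace (B p)"
    and "\<And>p. p \<in> P \<Longrightarrow> B p \<subseteq> Z p"
    and "\<And>p Q. p \<in> P \<Longrightarrow> Q \<subseteq> P \<Longrightarrow> p \<notin> Q \<Longrightarrow> Z p \<inter> sum Z Q = {0}"
  shows "qdim (sum Z P) (sum B P) = (\<Sum>p\<in>P. qdim (Z p) (B p))"
  using assms
proof (induction P)
  case empty
  then show ?case using qdim_eq_0_iff[of "{0}" "{0}"] by simp
next
  case (insert p P)
  have IH: "qdim (sum Z P) (sum B P) = (\<Sum>p\<in>P. qdim (Z p) (B p))"
    by (rule insert.IH) (use insert.prems in \<open>auto simp: subset_insertI2\<close>)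
  have "sum B P \<subseteq> sum Z P"
    using insert.hyps(1) insert.prems(3) by (intro sum_sets_mono) auto
  then have "qdim (Z p + sum Z P) (B p + sum B P) = qdim (Z p) (B p) + qdim (sum Z P) (sum B P)"
    using insert.hyps insert.prems(1-3) insert.prems(4)[of p P]
    by (intro qdim_direct_sum subspace_sum_sets) auto
  then show ?case using insert.hyps IH by simp
qed

text \<open>The last two hypotheses are surjectivity and injectivity of the map
  \<open>Z1/B1 \<rightarrow> Z2/B2\<close> induced by the inclusion.\<close>

lemma qdim_eqI:
  assumes "subspace Z1" "subspace B1" "subspace Z2" "subspace B2" "B1 \<subseteq> B2" "B2 \<subseteq> Z2" "Z1 \<subseteq> Z2" "B1 \<subseteq> Z1"
    and "Z2 \<subseteq> Z1 + B2" "Z1 \<inter> B2 \<subseteq> B1"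
  shows "qdim Z1 B1 = qdim Z2 B2"
proof -
  have "Z1 + B2 = Z2" "Z1 \<inter> B2 = B1" using assms set_plus_subset[of Z2 Z1 B2] by blast+
  then show ?thesis using qdim_second_iso[of Z1 B2] assms by simp
qed

text \<open>Rank and nullity: the kernel of the induced map is \<open>(Z1 \<inter> B2)/B1\<close>,
  and cancelling the finite rank \<open>qdim Z2 B2\<close> leaves nullity 0.\<close>

lemma surj_imp_inj:
  assumes "subspace Z1" "subspace B1" "subspace Z2" "subspace B2" "B1 \<subseteq> B2" "B2 \<subseteq> Z2" "Z1 \<subseteq> Z2" "B1 \<subseteq> Z1"
    and "Z2 \<subseteq> Z1 + B2" and eq: "qdim Z1 B1 = qdim Z2 B2" and fin: "qdim Z2 B2 \<noteq> \<infinity>"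
  shows "Z1 \<inter> B2 \<subseteq> B1"
proof -
  have "Z1 + B2 = Z2" using assms set_plus_subset[of Z2 Z1 B2] by blast
  then have "qdim Z1 (Z1 \<inter> B2) = qdim Z2 B2" using qdim_second_iso[of Z1 B2] assms by simp
  moreover have "qdim Z1 B1 = qdim Z1 (Z1 \<inter> B2) + qdim (Z1 \<inter> B2) B1"
    using assms by (intro qdim_add subspace_inter) auto
  ultimately have "qdim Z2 B2 = qdim (Z1 \<inter> B2) B1 + qdim Z2 B2"
    by (simp only: eq add.commute)
  then have "qdim (Z1 \<inter> B2) B1 = 0"
    using fin by (rule enat_eq_add_self)
  then show ?thesis using qdim_eq_0_iff[of "Z1 \<inter> B2" B1] assms by (auto simp: subspace_inter)
qed

text \<open>Dually, the image is \<open>(Z1 + B2)/B2\<close>, and cancelling its finite dimension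
  leaves a cokernel \<open>Z2/(Z1 + B2)\<close> of dimension 0.\<close>

lemma inj_imp_surj:
  assumes "subspace Z1" "subspace B1" "subspace Z2" "subspace B2" "B1 \<subseteq> B2" "B2 \<subseteq> Z2" "Z1 \<subseteq> Z2" "B1 \<subseteq> Z1"
    and "Z1 \<inter> B2 \<subseteq> B1" and eq: "qdim Z1 B1 = qdim Z2 B2" and fin: "qdim Z1 B1 \<noteq> \<infinity>"
  shows "Z2 \<subseteq> Z1 + B2"
proof -
  have "Z1 \<inter> B2 = B1" using assms by blast
  then have 1: "qdim (Z1 + B2) B2 = qdim Z1 B1" using qdim_second_iso[of Z1 B2] assms by simp
  have sub: "Z1 + B2 \<subseteq> Z2" "B2 \<subseteq> Z1 + B2"
    using assms set_plus_subset[of Z2 Z1 B2] subspace_0[of Z1] by (blast, force simp: set_plus_def)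
  have "qdim Z2 B2 = qdim Z2 (Z1 + B2) + qdim (Z1 + B2) B2"
    by (intro qdim_add subspace_set_plus) (fact assms sub)+
  then have "qdim Z2 (Z1 + B2) = 0"
    unfolding 1 eq[symmetric] using fin by (rule enat_eq_add_self)
  then show ?thesis
    using qdim_eq_0_iff[OF assms(3) subspace_set_plus[OF assms(1,4)] sub(1)] by blast
qed

subsection \<open>Finite dimensionality modulo a subspace\<close>

text \<open>Says that \<open>S\<close> has finite dimensional span modulo \<open>span T\<close>.
  With \<open>S\<close> and \<open>T\<close> arbitrary sets, the relation can be chained through
  intermediate sets without building any quotient.\<close>

definition finite_mod :: "'a set \<Rightarrow> 'a set \<Rightarrow> bool" where
  "finite_mod S T \<longleftrightarrow> (\<exists>F. finite F \<and> S \<subseteq> span (F \<union> T))"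

lemma finite_mod_mono: "finite_mod S T \<Longrightarrow> S' \<subseteq> S \<Longrightarrow> T \<subseteq> T' \<Longrightarrow> finite_mod S' T'"
  unfolding finite_mod_def by (meson Un_mono order_refl order_trans span_mono)

lemma finite_mod_subset: "S \<subseteq> T \<Longrightarrow> finite_mod S T"
  unfolding finite_mod_def using span_superset by (intro exI[of _ "{}"]) auto

lemma finite_mod_trans:
  assumes "finite_mod S T" "finite_mod T U"
  shows "finite_mod S U"
proof -
  obtain F G where "finite F" "S \<subseteq> span (F \<union> T)" "finite G" "T \<subseteq> span (G \<union> U)"
    using assms by (auto simp: finite_mod_def)
  moreover from this have "span (F \<union> T) \<subseteq> span ((F \<union> G) \<union> U)"
    using span_mono[of "G \<union> U" "(F \<union> G) \<union> U"] span_superset[of "(F \<union> G) \<union> U"]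
    by (intro span_minimal) auto
  ultimately show ?thesis unfolding finite_mod_def by (meson finite_UnI order_trans)
qed

lemma finite_mod_plus:
  assumes "finite_mod S U" "finite_mod T U"
  shows "finite_mod (S + T) U"
proof -
  obtain F G where "finite F" "S \<subseteq> span (F \<union> U)" "finite G" "T \<subseteq> span (G \<union> U)"
    using assms by (auto simp: finite_mod_def)
  moreover from this have "S + T \<subseteq> span ((F \<union> G) \<union> U)"
    using span_mono[of "G \<union> U" "(F \<union> G) \<union> U"] span_mono[of "F \<union> U" "(F \<union> G) \<union> U"]
    by (intro set_plus_subset) auto
  ultimately show ?thesis unfolding finite_mod_def by (meson finite_UnI)
qed

lemma finite_mod_plus_right: "finite_mod S T \<Longrightarrow> finite_mod (S + T) T"
  by (rule finite_mod_plus[OF _ finite_mod_subset[OF order_refl]])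

lemma finite_mod_plus_left: "finite_mod S T \<Longrightarrow> finite_mod (T + S) T"
  by (rule finite_mod_plus[OF finite_mod_subset[OF order_refl]])

lemma finite_mod_image:
  assumes f: "Vector_Spaces.linear scale scale f" and "finite_mod S T"
  shows "finite_mod (f ` S) (f ` T)"
proof -
  interpret f: Vector_Spaces.linear scale scale f by fact
  obtain F where F: "finite F" "S \<subseteq> span (F \<union> T)" using assms by (auto simp: finite_mod_def)
  have "f ` S \<subseteq> f ` span (F \<union> T)" using F by blast
  also have "\<dots> = span (f ` F \<union> f ` T)" by (simp add: f.span_image[symmetric] image_Un)
  finally show ?thesis using F by (auto simp: finite_mod_def)
qed

text \<open>The given generators modulo \<open>T\<close> may lie outside \<open>S\<close>. They are
  traded one at a time: \<open>f\<close> is absorbed into \<open>T\<close>, and since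
  \<open>span (insert f T)\<close> exceeds \<open>T\<close> by at most one dimension, one vector of
  \<open>S\<close> makes up for it.\<close>

lemma finite_mod_generators_inside:
  assumes S: "subspace S" and "subspace T" and "finite_mod S T"
  shows "\<exists>G. finite G \<and> G \<subseteq> S \<and> S \<subseteq> span (G \<union> (S \<inter> T))"
proof -
  obtain F where "finite F" "S \<subseteq> span (F \<union> T)" using assms by (auto simp: finite_mod_def)
  then show ?thesis using assms(2)
  proof (induction F arbitrary: T)
    case empty
    then have "S \<inter> T = S" by (metis Int_absorb2 span_eq_iff sup_bot_left)
    then show ?case by (intro exI[of _ "{}"]) (simp add: span_superset)
  next
    case (insert f F)
    let ?T = "span (insert f T)"
    have "insert f F \<union> T \<subseteq> span (F \<union> ?T)"
      using span_superset[of "insert f T"] span_superset[of "F \<union> ?T"] by auto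
    then have "S \<subseteq> span (F \<union> ?T)"
      using insert.prems(1) span_minimal[OF _ subspace_span] by (meson order_trans)
    then obtain G where G: "finite G" "G \<subseteq> S" "S \<subseteq> span (G \<union> (S \<inter> ?T))"
      using insert.IH[of ?T] by auto
    have "\<exists>s\<in>S. S \<inter> ?T \<subseteq> span (insert s (S \<inter> T))"
    proof (cases "S \<inter> ?T \<subseteq> T")
      case True
      then show ?thesis
        using subspace_0[OF S] span_superset[of "insert 0 (S \<inter> T)"] by (intro bexI[of _ 0]) auto
    next
      case False
      then obtain s where s: "s \<in> S" "s \<in> ?T" "s \<notin> T" by blast
      have spT: "span T = T" using insert.prems(2) by simp
      obtain k where k: "s - scale k f \<in> T" using s(2) unfolding span_insert spT by blast
      have k0: "k \<noteq> 0" using k s(3) by auto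
      have "x \<in> span (insert s (S \<inter> T))" if x: "x \<in> S" "x \<in> ?T" for x
      proof -
        obtain l where l: "x - scale l f \<in> T" using x(2) unfolding span_insert spT by blast
        \<comment> \<open>The factor \<open>l / k\<close> cancels the multiples of \<open>f\<close>,
          so that the difference falls into \<open>T\<close>.\<close>
        have "x - scale (l / k) s = (x - scale l f) - scale (l / k) (s - scale k f)"
          using k0 by (simp add: scale_right_diff_distrib)
        then have "x - scale (l / k) s \<in> S \<inter> T"
          using subspace_diff[OF insert.prems(2) l subspace_scale[OF insert.prems(2) k]]
            subspace_diff[OF S x(1) subspace_scale[OF S s(1)]] by (metis IntI)
        then show ?thesis unfolding span_insert using span_superset by blast
      qed
      then show ?thesis using s(1) by blast
    qed
    then obtain s where s: "s \<in> S" "S \<inter> ?T \<subseteq> span (insert s (S \<inter> T))" by blast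
    have "G \<union> (S \<inter> ?T) \<subseteq> span (insert s G \<union> (S \<inter> T))"
      using s(2) span_mono[of "insert s (S \<inter> T)" "insert s G \<union> (S \<inter> T)"]
        span_superset[of "insert s G \<union> (S \<inter> T)"] by auto
    then have "S \<subseteq> span (insert s G \<union> (S \<inter> T))"
      using G(3) span_minimal[OF _ subspace_span] by (meson order_trans)
    then show ?case using G s(1) by (intro exI[of _ "insert s G"]) auto
  qed
qed

text \<open>\<open>f\<close> induces an injection of \<open>S\<close> modulo the preimage of
  \<open>T\<close> into the image of \<open>S\<close> modulo \<open>T\<close>. Generators can be
  lifted to \<open>S\<close> only if they lie in that image, hence the appeal to
  \<open>finite_mod_generators_inside\<close>.\<close>

lemma finite_mod_vimage:
  assumes f: "Vector_Spaces.linear scale scale f" and S: "subspace S" and T: "subspace T"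
    and fin: "finite_mod (f ` S) T"
  shows "finite_mod S {x \<in> S. f x \<in> T}"
proof -
  interpret f: Vector_Spaces.linear scale scale f by fact
  obtain G where G: "finite G" "G \<subseteq> f ` S" "f ` S \<subseteq> span (G \<union> (f ` S \<inter> T))"
    using finite_mod_generators_inside[OF f.subspace_image[OF S] T fin] by blast
  obtain H where H: "finite H" "H \<subseteq> S" "G = f ` H"
    using finite_subset_image[OF G(1,2)] by blast
  let ?U = "{x \<in> S. f x \<in> T}"
  have U: "G \<union> (f ` S \<inter> T) = f ` (H \<union> ?U)" using H by auto
  have "x \<in> span (H \<union> ?U)" if x: "x \<in> S" for x
  proof -
    have "f x \<in> f ` span (H \<union> ?U)" using G(3) x unfolding U f.span_image by blast
    then obtain y where y: "y \<in> span (H \<union> ?U)" "f x = f y" by blast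
    have "y \<in> S" using y(1) span_minimal[OF _ S, of "H \<union> ?U"] H by blast
    then have "x - y \<in> ?U"
      using x y subspace_diff[OF S] subspace_0[OF T] by (simp add: f.diff)
    then show ?thesis using y(1) span_add[of y "H \<union> ?U" "x - y"] by (auto intro: span_base)
  qed
  then show ?thesis using H(1) by (auto simp: finite_mod_def)
qed

lemma finite_mod_Int:
  assumes "subspace S" "subspace T" "finite_mod S T"
  shows "finite_mod S (S \<inter> T)"
  using finite_mod_vimage[OF linear_id assms(1,2)] assms(3) by (simp add: Int_def)

text \<open>Finitely many generators modulo \<open>B\<close> involve only a finite
  \<open>H \<subseteq> F\<close>. As \<open>H\<close> then spans \<open>Z\<close> modulo
  \<open>B\<close>, independence of \<open>F\<close> and \<open>span F \<inter> B = {0}\<close>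
  leave nothing in \<open>F\<close> outside \<open>H\<close>.\<close>

lemma qdim_finite_iff:
  assumes Z: "subspace Z" and B: "subspace B" and BZ: "B \<subseteq> Z"
  shows "qdim Z B \<noteq> \<infinity> \<longleftrightarrow> finite_mod Z B"
proof -
  obtain F where F: "relative_basis Z B F" using relative_basis_exists assms by blast
  have span_B: "span (X \<union> B) = span X + B" for X
    unfolding span_Un_eq span_eq_iff[THEN iffD2, OF B] ..
  have Zs: "Z = span (F \<union> B)" and iF: "independent F" and FB: "span F \<inter> B = {0}"
    using F unfolding relative_basis_def span_B by auto
  have "finite F" if fm: "finite_mod Z B"
  proof -
    have "\<exists>H. finite H \<and> H \<subseteq> F \<and> Z \<subseteq> span (H \<union> B)"
    proof -
      obtain G where G: "finite G" "G \<subseteq> Z" "Z \<subseteq> span (G \<union> B)"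
        using finite_mod_generators_inside[OF Z B fm] BZ by (auto simp: Int_absorb1)
      have "\<exists>H. finite H \<and> H \<subseteq> F \<and> G \<subseteq> span (H \<union> B)" using G(1,2)
      proof (induction G)
        case (insert g G)
        then obtain H where H: "finite H" "H \<subseteq> F" "G \<subseteq> span (H \<union> B)" by auto
        have "g \<in> span F + B" using insert.prems unfolding Zs span_B by blast
        then obtain y b where yb: "g = y + b" "y \<in> span F" "b \<in> B" by (auto elim: set_plus_elim)
        then obtain t r where t: "finite t" "t \<subseteq> F" "y = (\<Sum>a\<in>t. scale (r a) a)"
          by (auto simp: span_explicit)
        have "y \<in> span ((H \<union> t) \<union> B)" unfolding t(3) using t(2) by (intro span_sum span_scale) (auto intro: span_base)
        moreover have "b \<in> span ((H \<union> t) \<union> B)" using yb by (auto intro: span_base)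
        ultimately have "g \<in> span ((H \<union> t) \<union> B)" using yb by (simp add: span_add)
        then show ?case
          using H t span_mono[of "H \<union> B" "(H \<union> t) \<union> B"] by (intro exI[of _ "H \<union> t"]) auto
      qed auto
      then obtain H where H: "finite H" "H \<subseteq> F" "G \<subseteq> span (H \<union> B)" by blast
      have "G \<union> B \<subseteq> span (H \<union> B)" using H span_superset[of "H \<union> B"] by auto
      then show ?thesis using H G(3) span_minimal[OF _ subspace_span] by (meson order_trans)
    qed
    then obtain H where H: "finite H" "H \<subseteq> F" "Z \<subseteq> span (H \<union> B)" by blast
    have "F \<subseteq> H"
    proof
      fix f assume f: "f \<in> F"
      have "f \<in> span H + B" using f H(3) relative_basis_subset[OF F B] unfolding span_B by blast
      then obtain u b where ub: "f = u + b" "u \<in> span H" "b \<in> B" by (auto elim: set_plus_elim)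
      have "f - u \<in> span F" using span_diff[OF span_base[OF f]] ub(2) span_mono[OF H(2)] by blast
      then have "b = 0" using ub FB by auto
      then have fH: "f \<in> span H" using ub by simp
      show "f \<in> H"
      proof (rule ccontr)
        assume "f \<notin> H"
        then have "H \<subseteq> F - {f}" using H(2) by blast
        then show False using fH iF f span_mono unfolding dependent_def by blast
      qed
    qed
    then show ?thesis using H(1) finite_subset by blast
  qed
  moreover have "finite_mod Z B" if "finite F"
    using that Zs by (auto simp: finite_mod_def)
  ultimately show ?thesis using edim_quotient_space[OF assms F] by auto
qed
end

section \<open>Homogeneous components\<close>

sublocale double_complex \<subseteq> complex_vector_space scale
  by unfold_locales

text \<open>The other half of the condition at \<open>(p, q)\<close> is the same statement for the complex with the
  two gradings and differentials interchanged.\<close>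

definition dd_half :: "(int \<Rightarrow> int \<Rightarrow> 'a set) \<Rightarrow> ('a \<Rightarrow> 'a) \<Rightarrow> ('a \<Rightarrow> 'a::zero) \<Rightarrow> int \<Rightarrow> int \<Rightarrow> bool" where
  "dd_half A d' d'' p q \<longleftrightarrow> range d' \<inter> {x. d'' x = 0} \<inter> A p q \<subseteq> range (d' \<circ> d'')"

context double_complex
begin

lemma module_hom_d': "module_hom scale scale d'" and module_hom_d'': "module_hom scale scale d''"
  using linear_d' linear_d'' by (simp_all add: module_hom_iff_linear)

lemmas d'_simps [simp] = module_hom.add[OF module_hom_d'] module_hom.diff[OF module_hom_d']
  module_hom.neg[OF module_hom_d'] module_hom.zero[OF module_hom_d'] module_hom.scale[OF module_hom_d']

lemmas d''_simps [simp] = module_hom.add[OF module_hom_d''] module_hom.diff[OF module_hom_d'']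
  module_hom.neg[OF module_hom_d''] module_hom.zero[OF module_hom_d''] module_hom.scale[OF module_hom_d'']

declare d'_d' [simp] d''_d'' [simp]

text \<open>Fixes the normal form with \<open>d'\<close> outermost; the interchanged complex
  supplies the opposite orientation.\<close>

lemma d''_d' [simp]: "d'' (d' x) = - d' (d'' x)"
  using d'_d''[of x] by (simp add: eq_neg_iff_add_eq_0 add.commute)

lemma range_d''_d': "range (d'' \<circ> d') = range (d' \<circ> d'')"
proof -
  have "d'' (d' x) = d' (d'' (- x))" "d' (d'' x) = d'' (d' (- x))" for x by simp_all
  then show ?thesis unfolding o_def by (metis (no_types, lifting) subset_antisym image_subsetI rangeI)
qed

lemma d'_A: "x \<in> A p q \<Longrightarrow> d' x \<in> A (p + 1) q" and d''_A: "x \<in> A p q \<Longrightarrow> d'' x \<in> A p (q + 1)"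
  using d'_bidegree d''_bidegree by blast+

lemma A_0 [simp]: "0 \<in> A p q" using subspace_A subspace_0 by blast

lemma linear_total_d: "Vector_Spaces.linear scale scale (total_d d' d'')"
  unfolding Vector_Spaces.linear_iff total_d_def
  by (auto simp: scale_right_distrib vector_space_axioms)

lemma total_d_simps [simp]:
  "total_d d' d'' (x + y) = total_d d' d'' x + total_d d' d'' y"
  "total_d d' d'' (x - y) = total_d d' d'' x - total_d d' d'' y"
  "total_d d' d'' 0 = 0"
  "total_d d' d'' (total_d d' d'' x) = 0"
  by (simp_all add: total_d_def)

section \<open>Projections onto the bidegrees\<close>

definition decomposition :: "'a \<Rightarrow> int \<times> int \<Rightarrow> 'a" where
  "decomposition x = (THE f. (\<forall>p q. f (p, q) \<in> A p q) \<and> finite {i. f i \<noteq> 0} \<and> x = Sum_any f)"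

lemma decomposition:
  "decomposition x (p, q) \<in> A p q" "finite {i. decomposition x i \<noteq> 0}" "x = Sum_any (decomposition x)"
  using theI'[OF direct_sum[of x]] unfolding decomposition_def by blast+

lemma decomposition_eqI:
  assumes "\<And>p q. f (p, q) \<in> A p q" "finite {i. f i \<noteq> 0}" "x = Sum_any f"
  shows "decomposition x = f"
  unfolding decomposition_def by (rule the1_equality[OF direct_sum]) (use assms in blast)

definition component :: "int \<Rightarrow> int \<Rightarrow> 'a \<Rightarrow> 'a" where
  "component p q x = decomposition x (p, q)"

lemma component_A: "component p q x \<in> A p q"
  by (simp add: component_def decomposition)

lemma linear_component: "Vector_Spaces.linear scale scale (component p q)"
proof -
  have "decomposition (x + y) = (\<lambda>i. decomposition x i + decomposition y i)" for x y
  proof (rule decomposition_eqI)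
    show "decomposition x (p, q) + decomposition y (p, q) \<in> A p q" for p q
      by (intro subspace_add subspace_A decomposition)
    show "finite {i. decomposition x i + decomposition y i \<noteq> 0}"
      by (rule finite_subset[OF _ finite_UnI[OF decomposition(2)[of x] decomposition(2)[of y]]]) auto
    show "x + y = (\<Sum>i. decomposition x i + decomposition y i)"
      by (subst Sum_any.distrib) (simp_all add: decomposition(2) decomposition(3)[symmetric])
  qed
  moreover have "decomposition (scale c x) = (\<lambda>i. scale c (decomposition x i))" for c x
  proof (rule decomposition_eqI)
    show "scale c (decomposition x (p, q)) \<in> A p q" for p q
      by (intro subspace_scale subspace_A decomposition)
    show "finite {i. scale c (decomposition x i) \<noteq> 0}"
      by (rule finite_subset[OF _ decomposition(2)[of x]]) auto
    show "scale c x = (\<Sum>i. scale c (decomposition x i))"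
      by (subst decomposition(3)[of x], subst (1 2) Sum_any.expand_superset[OF decomposition(2)[of x]])
        (auto simp: scale_sum_right)
  qed
  ultimately show ?thesis
    by (auto simp: Vector_Spaces.linear_iff component_def vector_space_axioms)
qed

lemmas module_hom_component = linear_component[folded module_hom_iff_linear]

lemmas component_simps [simp] =
  module_hom.add[OF module_hom_component] module_hom.diff[OF module_hom_component]
  module_hom.neg[OF module_hom_component] module_hom.zero[OF module_hom_component]
  module_hom.scale[OF module_hom_component]

lemma component_homogeneous:
  assumes "x \<in> A p q"
  shows "component p' q' x = (if p' = p \<and> q' = q then x else 0)"
proof -
  have "decomposition x = (\<lambda>i. if i = (p, q) then x else 0)"
    using assms by (intro decomposition_eqI) auto
  then show ?thesis by (simp add: component_def)
qed

lemma component_same [simp]: "x \<in> A p q \<Longrightarrow> component p q x = x"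
  by (simp add: component_homogeneous)

lemma sum_components:
  assumes "finite I" "{i. decomposition x i \<noteq> 0} \<subseteq> I"
  shows "x = (\<Sum>(p, q)\<in>I. component p q x)"
  using decomposition(3)[of x] Sum_any.expand_superset[OF assms]
  by (simp add: component_def case_prod_beta)

text \<open>Verified on homogeneous elements and extended along the finite decomposition. As a simp
  rule it pushes projections through the differentials, so that identities can be checked bidegree
  by bidegree.\<close>

lemma component_d' [simp]: "component p q (d' x) = d' (component (p - 1) q x)"
proof -
  let ?I = "{i. decomposition x i \<noteq> 0}"
  have hom: "component p q (d' y) = d' (component (p - 1) q y)" if "y \<in> A p' q'" for y p' q'
    using component_homogeneous[OF d'_A[OF that], of p q] component_homogeneous[OF that, of "p - 1" q]
    by auto
  have x: "x = (\<Sum>(p, q)\<in>?I. component p q x)" by (rule sum_components[OF decomposition(2)]) simp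
  have "component p q (d' (\<Sum>(r, s)\<in>?I. component r s x)) = d' (component (p - 1) q (\<Sum>(r, s)\<in>?I. component r s x))"
    by (simp add: module_hom.sum[OF module_hom_d'] module_hom.sum[OF module_hom_component]
        hom[OF component_A] case_prod_beta)
  then show ?thesis using x by simp
qed

lemma component_d'' [simp]: "component p q (d'' x) = d'' (component p (q - 1) x)"
proof -
  let ?I = "{i. decomposition x i \<noteq> 0}"
  have hom: "component p q (d'' y) = d'' (component p (q - 1) y)" if "y \<in> A p' q'" for y p' q'
    using component_homogeneous[OF d''_A[OF that], of p q] component_homogeneous[OF that, of p "q - 1"]
    by auto
  have x: "x = (\<Sum>(p, q)\<in>?I. component p q x)" by (rule sum_components[OF decomposition(2)]) simp
  have "component p q (d'' (\<Sum>(r, s)\<in>?I. component r s x)) = d'' (component p (q - 1) (\<Sum>(r, s)\<in>?I. component r s x))"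
    by (simp add: module_hom.sum[OF module_hom_d''] module_hom.sum[OF module_hom_component]
        hom[OF component_A] case_prod_beta)
  then show ?thesis using x by simp
qed

lemma component_component [simp]:
  "component p q (component p' q' x) = (if p = p' \<and> q = q' then component p q x else 0)"
  using component_homogeneous[OF component_A] by auto

lemma eq_componentsI:
  assumes "\<And>p q. component p q x = component p q y" shows "x = y"
proof -
  have "decomposition x = decomposition y"
    using assms by (auto simp: component_def)
  then show ?thesis by (metis decomposition(3))
qed

lemma A_iff: "x \<in> A p q \<longleftrightarrow> (\<forall>p' q'. p' \<noteq> p \<or> q' \<noteq> q \<longrightarrow> component p' q' x = 0)"
proof
  assume *: "\<forall>p' q'. p' \<noteq> p \<or> q' \<noteq> q \<longrightarrow> component p' q' x = 0"
  have "x = component p q x" by (rule eq_componentsI) (use * in auto)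
  then show "x \<in> A p q" using component_A by metis
qed (auto simp: component_homogeneous)

lemma subspace_total_part: "subspace (total_part scale A k)"
  by (simp add: total_part_def)

text \<open>Replaces the span by vanishing of components, the form in which total degrees are
  tracked below.\<close>

lemma total_part_iff: "x \<in> total_part scale A k \<longleftrightarrow> (\<forall>p q. p + q \<noteq> k \<longrightarrow> component p q x = 0)"
proof
  assume "x \<in> total_part scale A k"
  then show "\<forall>p q. p + q \<noteq> k \<longrightarrow> component p q x = 0"
    unfolding total_part_def
    by (induction rule: span_induct) (auto simp: subspace_def component_homogeneous)
next
  assume *: "\<forall>p q. p + q \<noteq> k \<longrightarrow> component p q x = 0"
  have "component p q x \<in> span (\<Union>p. A p (k - p))" for p q
  proof (cases "p + q = k")
    case True
    then have "q = k - p" by simp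
    then show ?thesis using component_A[of p q x] by (auto intro!: span_base)
  next
    case False
    then show ?thesis using * by (simp add: span_zero)
  qed
  then have "(\<Sum>(p, q)\<in>{i. decomposition x i \<noteq> 0}. component p q x) \<in> span (\<Union>p. A p (k - p))"
    by (auto intro!: span_sum)
  then show "x \<in> total_part scale A k"
    using sum_components[OF decomposition(2)[of x] order_refl] by (simp add: total_part_def)
qed

lemma A_total_part: "x \<in> A p q \<Longrightarrow> p + q = k \<Longrightarrow> x \<in> total_part scale A k"
  by (auto simp: total_part_iff component_homogeneous)

lemma d'_total_part: "x \<in> total_part scale A k \<Longrightarrow> k + 1 = l \<Longrightarrow> d' x \<in> total_part scale A l"
  and d''_total_part: "x \<in> total_part scale A k \<Longrightarrow> k + 1 = l \<Longrightarrow> d'' x \<in> total_part scale A l"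
  by (auto simp: total_part_iff)

text \<open>A \<open>d'\<close>-preimage of a homogeneous element may be replaced by its component
  of the matching bidegree; the next two lemmas do the same for \<open>d' \<circ> d''\<close> and
  for sums.\<close>

lemma range_d'_A: "range d' \<inter> A p q = d' ` A (p - 1) q"
proof
  show "range d' \<inter> A p q \<subseteq> d' ` A (p - 1) q"
  proof
    fix x assume x: "x \<in> range d' \<inter> A p q"
    then obtain y where "x = d' y" by auto
    then have "x = d' (component (p - 1) q y)"
      using x component_same[of x p q] by simp
    then show "x \<in> d' ` A (p - 1) q" using component_A by blast
  qed
  show "d' ` A (p - 1) q \<subseteq> range d' \<inter> A p q"
    using d'_A[of _ "p - 1" q] by auto
qed

lemma range_d'_d''_A: "range (d' \<circ> d'') \<inter> A p q = (\<lambda>x. d' (d'' x)) ` A (p - 1) (q - 1)"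
proof
  show "range (d' \<circ> d'') \<inter> A p q \<subseteq> (\<lambda>x. d' (d'' x)) ` A (p - 1) (q - 1)"
  proof
    fix x assume x: "x \<in> range (d' \<circ> d'') \<inter> A p q"
    then obtain y where "x = d' (d'' y)" by auto
    then have "x = d' (d'' (component (p - 1) (q - 1) y))"
      using x component_same[of x p q] by simp
    then show "x \<in> (\<lambda>x. d' (d'' x)) ` A (p - 1) (q - 1)" using component_A by blast
  qed
  show "(\<lambda>x. d' (d'' x)) ` A (p - 1) (q - 1) \<subseteq> range (d' \<circ> d'') \<inter> A p q"
    using d'_A[OF d''_A, of _ "p - 1" "q - 1"] by auto
qed

lemma range_sum_A: "(range d' + range d'') \<inter> A p q = d' ` A (p - 1) q + d'' ` A p (q - 1)"
proof
  show "(range d' + range d'') \<inter> A p q \<subseteq> d' ` A (p - 1) q + d'' ` A p (q - 1)"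
  proof
    fix x assume x: "x \<in> (range d' + range d'') \<inter> A p q"
    then obtain u v where "x = d' u + d'' v" by (auto elim!: set_plus_elim)
    then have "x = d' (component (p - 1) q u) + d'' (component p (q - 1) v)"
      using x component_same[of x p q] by simp
    then show "x \<in> d' ` A (p - 1) q + d'' ` A p (q - 1)" using component_A by blast
  qed
  show "d' ` A (p - 1) q + d'' ` A p (q - 1) \<subseteq> (range d' + range d'') \<inter> A p q"
    using d'_A[of _ "p - 1" q] d''_A[of _ p "q - 1"]
    by (intro Int_greatest set_plus_mono2 set_plus_subset subspace_A) auto
qed

text \<open>By anticommutation \<open>range (d' \<circ> d'')\<close> is always contained in the
  other two sets. So the two equalities amount to two inclusions into it, one for each differential,
  and the second is the first one for the interchanged complex at \<open>(q, p)\<close>.\<close>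

lemma dd_lemma_at_iff:
  "dd_lemma_at A d' d'' p q \<longleftrightarrow> dd_half A d' d'' p q \<and> dd_half (\<lambda>p q. A q p) d'' d' q p"
proof -
  have 1: "range (d' \<circ> d'') \<subseteq> range d' \<inter> {x. d'' x = 0}" by auto
  have "range (d'' \<circ> d') \<subseteq> range d'' \<inter> {x. d' x = 0}"
    unfolding o_def by (intro image_subsetI IntI rangeI CollectI) simp
  then have 2: "range (d' \<circ> d'') \<subseteq> {x. d' x = 0} \<inter> range d''"
    unfolding range_d''_d' by blast
  show ?thesis
    unfolding dd_lemma_at_def dd_half_def range_d''_d' using 1 2 by blast
qed

text \<open>The symmetry behind all halved arguments. The axioms treat \<open>d'\<close> and
  \<open>d''\<close> alike; only the decomposition has to be reindexed by
  \<open>prod.swap\<close>.\<close>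

lemma double_complex_swap: "double_complex scale (\<lambda>p q. A q p) d'' d'"
proof (unfold_locales)
  show "\<exists>!f. (\<forall>p q. f (p, q) \<in> A q p) \<and> finite {i. f i \<noteq> 0} \<and> x = Sum_any f" for x
  proof (rule ex1I)
    let ?g = "\<lambda>i. decomposition x (prod.swap i)"
    have f: "{i. f (prod.swap i) \<noteq> 0} = prod.swap ` {i. f i \<noteq> (0::'a)}" for f
      by (force simp: image_iff)
    have S: "Sum_any (\<lambda>i. f (prod.swap i)) = Sum_any f" for f :: "int \<times> int \<Rightarrow> 'a"
      by (rule Sum_any.reindex_cong[of prod.swap]) (auto simp: o_def intro!: inj_onI)
    show "(\<forall>p q. ?g (p, q) \<in> A q p) \<and> finite {i. ?g i \<noteq> 0} \<and> x = Sum_any ?g"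
      by (simp add: decomposition(1,2) decomposition(3)[symmetric] f S)
    fix h assume h: "(\<forall>p q. h (p, q) \<in> A q p) \<and> finite {i. h i \<noteq> 0} \<and> x = Sum_any h"
    have "decomposition x = (\<lambda>i. h (prod.swap i))"
      using h by (intro decomposition_eqI) (simp_all add: f S)
    then show "h = ?g" by simp
  qed
qed (use linear_d' linear_d'' subspace_A d'_bidegree d''_bidegree in \<open>auto simp: Vector_Spaces.linear_iff\<close>)

lemma total_part_swap: "total_part scale (\<lambda>p q. A q p) k = total_part scale A k"
proof -
  have "(\<Union>p. A (k - p) p) = (\<Union>p. A p (k - p))"
  proof (intro subset_antisym UN_least)
    fix p
    show "A (k - p) p \<subseteq> (\<Union>p. A p (k - p))" "A p (k - p) \<subseteq> (\<Union>p. A (k - p) p)"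
      using UN_upper[of "k - p" UNIV "\<lambda>p. A p (k - p)"] UN_upper[of "k - p" UNIV "\<lambda>p. A (k - p) p"]
      by simp_all
  qed
  then show ?thesis by (simp add: total_part_def)
qed

lemma total_d_swap: "total_d d'' d' = total_d d' d''"
  by (rule ext) (simp add: total_d_def add.commute)

lemma subspace_kernel_d': "subspace {x. d' x = 0}" and subspace_kernel_d'': "subspace {x. d'' x = 0}"
  and subspace_kernel_total_d: "subspace {x. total_d d' d'' x = 0}"
  and subspace_kernel_d'_d'': "subspace {x. (d' \<circ> d'') x = 0}"
  using module_hom.subspace_kernel[OF module_hom_d'] module_hom.subspace_kernel[OF module_hom_d'']
    module_hom.subspace_kernel[OF linear_total_d[folded module_hom_iff_linear]]
    module_hom.subspace_linear_preimage[OF module_hom_d'' module_hom.subspace_kernel[OF module_hom_d']]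
  by simp_all

lemma subspace_d'_image: "subspace S \<Longrightarrow> subspace (d' ` S)"
  and subspace_d''_image: "subspace S \<Longrightarrow> subspace (d'' ` S)"
  and subspace_total_d_image: "subspace S \<Longrightarrow> subspace (total_d d' d'' ` S)"
  using module_hom.subspace_image[OF module_hom_d'] module_hom.subspace_image[OF module_hom_d'']
    module_hom.subspace_image[OF linear_total_d[folded module_hom_iff_linear]] by blast+

lemma subspace_range_d': "subspace (range d')" and subspace_range_d'': "subspace (range d'')"
  and subspace_range_d'_d'': "subspace (range (d' \<circ> d''))"
  using subspace_d'_image[of UNIV] subspace_d''_image[of UNIV] subspace_d'_image[of "range d''"]
  by (simp_all add: image_comp)

lemmas subspaces = subspace_kernel_d' subspace_kernel_d'' subspace_kernel_total_d
  subspace_kernel_d'_d'' subspace_d'_image subspace_d''_image subspace_total_d_image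
  subspace_range_d' subspace_range_d'' subspace_range_d'_d''
  subspace_set_plus subspace_inter subspace_A subspace_total_part

lemma kernel_sub: "{x. d' x = 0} \<inter> {x. d'' x = 0} \<subseteq> {x. total_d d' d'' x = 0}"
  "{x. total_d d' d'' x = 0} \<subseteq> {x. (d' \<circ> d'') x = 0}"
proof -
  show "{x. d' x = 0} \<inter> {x. d'' x = 0} \<subseteq> {x. total_d d' d'' x = 0}"
    by (auto simp: total_d_def)
  have "d' (d'' x) = d' (total_d d' d'' x)" for x by (simp add: total_d_def)
  then show "{x. total_d d' d'' x = 0} \<subseteq> {x. (d' \<circ> d'') x = 0}" by auto
qed

lemma total_d_closedD:
  assumes "total_d d' d'' x = 0"
  shows "d'' x = - d' x" "d' (d'' x) = 0"
  using assms kernel_sub(2) by (auto simp: total_d_def eq_neg_iff_add_eq_0 add.commute)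

lemma total_d_total_part: "x \<in> total_part scale A k \<Longrightarrow> k + 1 = l \<Longrightarrow> total_d d' d'' x \<in> total_part scale A l"
  unfolding total_d_def by (intro subspace_add subspace_total_part d'_total_part d''_total_part)

end

section \<open>Totally bounded complexes: total degrees as finite direct sums\<close>

locale bounded_double_complex = double_complex +
  assumes bounded: "totally_bounded_complex A"
begin

lemma bounded_double_complex_swap: "bounded_double_complex scale (\<lambda>p q. A q p) d'' d'"
proof -
  have "{(p, q). A q p \<noteq> {0}} = prod.swap ` {(p, q). A p q \<noteq> {0}}" by (force simp: image_iff)
  then show ?thesis
    using bounded double_complex_swap unfolding bounded_double_complex_def bounded_double_complex_axioms_def
      totally_bounded_complex_def by simp
qed

text \<open>First indices are enough: in total degree \<open>k\<close> the second index is
  \<open>k - p\<close>, so a finite sum over \<open>support\<close> exhausts that degree.\<close>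

definition support :: "int set" where
  "support = fst ` {(p, q). A p q \<noteq> {0}}"

lemma finite_support: "finite support"
  using bounded by (simp add: support_def totally_bounded_complex_def)

lemma A_outside_support: "p \<notin> support \<Longrightarrow> A p q = {0}"
  by (force simp: support_def image_iff)

lemma component_outside_support: "p \<notin> support \<Longrightarrow> component p q x = 0"
  using A_outside_support component_A by blast

text \<open>The projection of the total space onto \<open>total_part scale A k\<close>.\<close>

definition degree_part :: "int \<Rightarrow> 'a \<Rightarrow> 'a" where
  "degree_part k x = (\<Sum>p\<in>support. component p (k - p) x)"

lemma component_degree_part [simp]:
  "component p q (degree_part k x) = (if p + q = k then component p q x else 0)"
proof -
  have "component p q (degree_part k x) = (\<Sum>r\<in>support. if r = p then (if p + q = k then component p q x else 0) else 0)"
    unfolding degree_part_def module_hom.sum[OF module_hom_component] by (intro sum.cong) auto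
  then show ?thesis using component_outside_support[of p q x] by (simp add: finite_support)
qed

lemma degree_part_total_part: "degree_part k x \<in> total_part scale A k"
  by (auto simp: total_part_iff)

lemma degree_part_d': "degree_part k (d' x) = d' (degree_part (k - 1) x)"
  and degree_part_d'': "degree_part k (d'' x) = d'' (degree_part (k - 1) x)"
  by (rule eq_componentsI; auto)+

lemma degree_part_same: "x \<in> total_part scale A k \<Longrightarrow> degree_part k x = x"
  by (rule eq_componentsI) (auto simp: total_part_iff)

lemma degree_part_add: "degree_part k (x + y) = degree_part k x + degree_part k y"
  by (rule eq_componentsI) auto

lemma range_d'_d''_total_part:
  assumes "x \<in> range (d' \<circ> d'')" "x \<in> total_part scale A k"
  obtains y where "y \<in> total_part scale A (k - 2)" "x = d' (d'' y)"
proof -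
  obtain y where "x = d' (d'' y)" using assms(1) by auto
  then have "x = d' (d'' (degree_part (k - 1 - 1) y))"
    using degree_part_same[OF assms(2)] by (metis degree_part_d' degree_part_d'')
  then show ?thesis using that[OF degree_part_total_part] by simp
qed

lemma range_sum_total_part:
  assumes "x \<in> range d' + range d''" "x \<in> total_part scale A k"
  obtains u v where "u \<in> total_part scale A (k - 1)" "v \<in> total_part scale A (k - 1)" "x = d' u + d'' v"
proof -
  obtain u v where "x = d' u + d'' v" using assms(1) by (auto elim!: set_plus_elim)
  then have "x = d' (degree_part (k - 1) u) + d'' (degree_part (k - 1) v)"
    using degree_part_same[OF assms(2)] by (metis degree_part_d' degree_part_d'' degree_part_add)
  then show ?thesis using that[OF degree_part_total_part degree_part_total_part] by simp
qed

definition graded :: "'a set \<Rightarrow> bool" where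
  "graded S \<longleftrightarrow> subspace S \<and> (\<forall>x\<in>S. \<forall>p q. component p q x \<in> S)"

lemma graded_total_part:
  assumes S: "graded S"
  shows "S \<inter> total_part scale A k = (\<Sum>p\<in>support. S \<inter> A p (k - p))"
proof
  have "subspace S" using S by (simp add: graded_def)
  show "S \<inter> total_part scale A k \<subseteq> (\<Sum>p\<in>support. S \<inter> A p (k - p))"
  proof
    fix x assume x: "x \<in> S \<inter> total_part scale A k"
    then have "x = (\<Sum>p\<in>support. component p (k - p) x)"
      using degree_part_same[of x k] by (simp add: degree_part_def)
    also have "\<dots> \<in> (\<Sum>p\<in>support. S \<inter> A p (k - p))"
      using S x finite_support by (intro set_sum_alt[THEN equalityD2, THEN subsetD])
        (auto simp: graded_def component_A)
    finally show "x \<in> (\<Sum>p\<in>support. S \<inter> A p (k - p))" .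
  qed
  have "(\<Sum>p\<in>P. S \<inter> A p (k - p)) \<subseteq> S \<inter> total_part scale A k" for P
    using subspace_inter[OF \<open>subspace S\<close> subspace_total_part[of k]] A_total_part
    by (intro sum_sets_subset) auto
  then show "(\<Sum>p\<in>support. S \<inter> A p (k - p)) \<subseteq> S \<inter> total_part scale A k" .
qed

text \<open>Both subspaces are in each total degree the direct sum of their homogeneous parts, so
  the sum over bidegrees is the dimension of one quotient. This makes \<open>total_dim\<close>
  comparable with Betti numbers through inclusions.\<close>

lemma total_dim_eq_qdim:
  assumes Z: "graded Z" and B: "graded B" and BZ: "B \<subseteq> Z"
  shows "total_dim (\<lambda>p q. qdim (Z \<inter> A p q) (B \<inter> A p q)) k
    = qdim (Z \<inter> total_part scale A k) (B \<inter> total_part scale A k)"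
proof -
  have sub: "subspace (Z \<inter> A p q)" "subspace (B \<inter> A p q)" for p q
    using Z B by (auto simp: graded_def intro!: subspaces)
  have "qdim (Z \<inter> A p q) (B \<inter> A p q) = 0" if "p \<notin> support" for p q
    using qdim_eq_0_iff[OF sub, of p q p q] A_outside_support[OF that] sub subspace_0 BZ by fastforce
  \<comment> \<open>The terms vanish off \<open>support\<close>, so \<open>Sum_any\<close> has
    finite support and its default value 0 does not interfere.\<close>
  then have "total_dim (\<lambda>p q. qdim (Z \<inter> A p q) (B \<inter> A p q)) k
      = (\<Sum>p\<in>support. qdim (Z \<inter> A p (k - p)) (B \<inter> A p (k - p)))"
    unfolding total_dim_def by (intro Sum_any.expand_superset finite_support) auto
  also have "\<dots> = qdim (\<Sum>p\<in>support. Z \<inter> A p (k - p)) (\<Sum>p\<in>support. B \<inter> A p (k - p))"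
  proof (intro qdim_direct_sum_family[symmetric] finite_support sub)
    show "Z \<inter> A p (k - p) \<inter> (\<Sum>p\<in>Q. Z \<inter> A p (k - p)) = {0}" if "p \<notin> Q" for p Q
    proof -
      have K: "subspace {x. component p (k - p) x = 0}" by (auto simp: subspace_def)
      have "(\<Sum>p\<in>Q. Z \<inter> A p (k - p)) \<subseteq> {x. component p (k - p) x = 0}"
        using that component_homogeneous by (intro sum_sets_subset[OF K]) auto
      moreover have "0 \<in> (\<Sum>p\<in>Q. Z \<inter> A p (k - p))"
        using sub by (intro subspace_0 subspace_sum_sets)
      ultimately show ?thesis using subspace_0[OF sub(1)] by auto
    qed
  qed (use BZ in auto)
  finally show ?thesis by (simp only: graded_total_part[OF Z] graded_total_part[OF B])
qed

lemma graded_sets: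
  "graded ({x. d' x = 0} \<inter> {x. d'' x = 0})" "graded (range (d' \<circ> d''))"
  "graded {x. (d' \<circ> d'') x = 0}" "graded (range d' + range d'')"
proof -
  have *: "d' (component p q x) = 0" if "d' x = 0" for p q x
    using that component_d'[of "p + 1" q x] by simp
  have **: "d'' (component p q x) = 0" if "d'' x = 0" for p q x
    using that component_d''[of p "q + 1" x] by simp
  have ***: "d' (d'' (component p q x)) = 0" if "d' (d'' x) = 0" for p q x
    using that component_d'[of "p + 1" "q + 1" "d'' x"] by simp
  show "graded ({x. d' x = 0} \<inter> {x. d'' x = 0})" "graded {x. (d' \<circ> d'') x = 0}"
    using * ** *** subspaces(1,2,4) by (auto simp: graded_def intro!: subspace_inter)
  show "graded (range (d' \<circ> d''))"
    using subspace_range_d'_d'' by (auto simp: graded_def o_def)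
  show "graded (range d' + range d'')"
    by (fastforce simp: graded_def intro!: subspaces elim!: set_plus_elim)
qed

lemma total_dim_h_BC: "total_dim (h_BC scale A d' d'') k =
    qdim ({x. d' x = 0} \<inter> {x. d'' x = 0} \<inter> total_part scale A k) (range (d' \<circ> d'') \<inter> total_part scale A k)"
proof -
  have "range (d' \<circ> d'') \<subseteq> {x. d' x = 0} \<inter> {x. d'' x = 0}" by auto
  from total_dim_eq_qdim[OF graded_sets(1,2) this] show ?thesis
    unfolding h_BC_def H_BC_def .
qed

lemma total_dim_h_A: "total_dim (h_A scale A d' d'') k =
    qdim ({x. (d' \<circ> d'') x = 0} \<inter> total_part scale A k) ((range d' + range d'') \<inter> total_part scale A k)"
proof -
  have "range d' + range d'' \<subseteq> {x. (d' \<circ> d'') x = 0}" by (auto elim!: set_plus_elim)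
  from total_dim_eq_qdim[OF graded_sets(3,4) this] show ?thesis
    unfolding h_A_def H_A_def .
qed

end

section \<open>Comparison maps between the cohomologies\<close>

context double_complex
begin

lemma range_d'_d''_obtain:
  assumes "x \<in> range (d' \<circ> d'')" "x \<in> A p q"
  obtains y where "y \<in> A (p - 1) (q - 1)" "x = d' (d'' y)"
  using assms range_d'_d''_A[of p q] by blast

lemma dd_halfD: "dd_half A d' d'' p q \<Longrightarrow> d'' (d' x) = 0 \<Longrightarrow> d' x \<in> A p q \<Longrightarrow> d' x \<in> range (d' \<circ> d'')"
  unfolding dd_half_def by blast

lemma dd_half_swapD:
  "dd_half (\<lambda>p q. A q p) d'' d' q p \<Longrightarrow> d' (d'' x) = 0 \<Longrightarrow> d'' x \<in> A p q \<Longrightarrow> d'' x \<in> range (d' \<circ> d'')"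
  unfolding dd_half_def range_d''_d' by blast

text \<open>If \<open>d'' x = d' (d'' y)\<close>, then \<open>x + d' y\<close> is also
  \<open>d''\<close>-closed, as \<open>d'' (d' y) = - d' (d'' y)\<close>; it represents the same
  class in \<open>H_d'\<close>.\<close>

lemma kernel_d'_with_exact_d'':
  assumes "x \<in> A p q" "d' x = 0" "d'' x \<in> range (d' \<circ> d'')"
  shows "x \<in> {x. d' x = 0} \<inter> {x. d'' x = 0} \<inter> A p q + d' ` A (p - 1) q"
proof -
  obtain y where y: "y \<in> A (p - 1) q" "d'' x = d' (d'' y)"
    using range_d'_d''_obtain[of "d'' x" p "q + 1"] d''_A assms by auto
  have "x + d' y \<in> {x. d' x = 0} \<inter> {x. d'' x = 0} \<inter> A p q"
    using assms y d'_A[OF y(1)] by (auto intro!: subspace_add[OF subspace_A])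
  moreover have "d' (- y) \<in> d' ` A (p - 1) q" using y(1) subspace_neg[OF subspace_A] by blast
  ultimately have "(x + d' y) + d' (- y) \<in> {x. d' x = 0} \<inter> {x. d'' x = 0} \<inter> A p q + d' ` A (p - 1) q"
    by (rule set_plus_intro)
  then show ?thesis by simp
qed

text \<open>The half for \<open>d''\<close> enters one step up, at \<open>(p, q + 1)\<close>,
  because that is where \<open>d'' x\<close> lives.\<close>

lemma BC_to_d'_surj:
  assumes "dd_half (\<lambda>p q. A q p) d'' d' (q + 1) p"
  shows "{x. d' x = 0} \<inter> A p q \<subseteq> {x. d' x = 0} \<inter> {x. d'' x = 0} \<inter> A p q + d' ` A (p - 1) q"
proof
  fix x assume x: "x \<in> {x. d' x = 0} \<inter> A p q"
  have "d' (d'' x) = 0" using x d''_d'[of x] by simp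
  then have "d'' x \<in> range (d' \<circ> d'')" using dd_half_swapD[OF assms] d''_A x by blast
  then show "x \<in> {x. d' x = 0} \<inter> {x. d'' x = 0} \<inter> A p q + d' ` A (p - 1) q"
    using kernel_d'_with_exact_d'' x by blast
qed

text \<open>The kernel of \<open>H_BC \<rightarrow> H_d'\<close> measures exactly the failure of one
  half, so injectivity obtained by counting dimensions returns that half.\<close>

lemma BC_to_d'_inj_iff:
  "{x. d' x = 0} \<inter> {x. d'' x = 0} \<inter> A p q \<inter> d' ` A (p - 1) q \<subseteq> range (d' \<circ> d'') \<inter> A p q
    \<longleftrightarrow> dd_half A d' d'' p q"
  unfolding dd_half_def range_d'_A[symmetric] by auto

text \<open>If \<open>d' u + d'' v\<close> is \<open>d'\<close>-closed, then
  \<open>d' (d'' v) = 0\<close>, and the half for \<open>d''\<close> turns the offending term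
  \<open>d'' v\<close> into a \<open>d'\<close>-boundary.\<close>

lemma d'_to_A_inj:
  assumes "dd_half (\<lambda>p q. A q p) d'' d' q p"
  shows "{x. d' x = 0} \<inter> A p q \<inter> ((range d' + range d'') \<inter> A p q) \<subseteq> d' ` A (p - 1) q"
proof
  fix x assume x: "x \<in> {x. d' x = 0} \<inter> A p q \<inter> ((range d' + range d'') \<inter> A p q)"
  then obtain u v where uv: "x = d' u + d'' v" "v \<in> A p (q - 1)"
    unfolding range_sum_A by (auto elim!: set_plus_elim)
  have "d' (d'' v) = 0" using x uv by simp
  then have "d'' v \<in> range (d' \<circ> d'')" using dd_half_swapD[OF assms] d''_A[OF uv(2)] by simp
  then obtain y where "d'' v = d' (d'' y)" by auto
  then have "x = d' (u + d'' y)" using uv by simp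
  then show "x \<in> d' ` A (p - 1) q" using x range_d'_A[of p q] by blast
qed

text \<open>The shift to \<open>p + 1\<close> comes from passing from \<open>x\<close> to
  \<open>d' x\<close>: the condition \<open>d' (d'' x) = 0\<close> says that \<open>d' x\<close> is
  \<open>d''\<close>-closed, and \<open>d' x = d' (d'' y)\<close> says that subtracting
  \<open>d'' y\<close> makes \<open>x\<close> \<open>d'\<close>-closed.\<close>

lemma d'_to_A_surj_iff:
  "{x. (d' \<circ> d'') x = 0} \<inter> A p q \<subseteq> {x. d' x = 0} \<inter> A p q + (range d' + range d'') \<inter> A p q
    \<longleftrightarrow> dd_half A d' d'' (p + 1) q" (is "?surj \<longleftrightarrow> ?dd")
proof
  assume surj: ?surj
  show ?dd unfolding dd_half_def
  proof
    fix z assume z: "z \<in> range d' \<inter> {x. d'' x = 0} \<inter> A (p + 1) q"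
    then obtain x where x: "x \<in> A p q" "z = d' x" using range_d'_A[of "p + 1" q] by auto
    then have "(d' \<circ> d'') x = 0" using z d''_d'[of x] by simp
    then obtain c u v where "d' c = 0" "x = c + (d' u + d'' v)"
      using surj x(1) by (auto elim!: set_plus_elim dest!: subsetD)
    then show "z \<in> range (d' \<circ> d'')" using x by simp
  qed
next
  assume dd: ?dd
  show ?surj
  proof
    fix x assume x: "x \<in> {x. (d' \<circ> d'') x = 0} \<inter> A p q"
    then have "d' x \<in> range (d' \<circ> d'')" using dd_halfD[OF dd _ d'_A] by simp
    then obtain y where y: "y \<in> A p (q - 1)" "d' x = d' (d'' y)"
      using range_d'_d''_obtain[of "d' x" "p + 1" q] d'_A x by auto
    have yA: "d'' y \<in> A p q" using d''_A[OF y(1)] by simp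
    have "0 + d'' y \<in> range d' + range d''"
      by (intro set_plus_intro rangeI) (metis d'_simps(4) rangeI)
    then have "(x - d'' y) + d'' y \<in> {x. d' x = 0} \<inter> A p q + (range d' + range d'') \<inter> A p q"
      using x y(2) yA subspace_diff[OF subspace_A] by (intro set_plus_intro) auto
    then show "x \<in> {x. d' x = 0} \<inter> A p q + (range d' + range d'') \<inter> A p q" by simp
  qed
qed

lemma dd_half_total_part:
  assumes "\<And>p q. p + q = k \<Longrightarrow> dd_half A d' d'' p q"
  shows "range d' \<inter> {x. d'' x = 0} \<inter> total_part scale A k \<subseteq> range (d' \<circ> d'')"
proof
  fix z assume z: "z \<in> range d' \<inter> {x. d'' x = 0} \<inter> total_part scale A k"
  then obtain x where x: "z = d' x" by blast
  have "component p q z \<in> range (d' \<circ> d'')" for p q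
  proof (cases "p + q = k")
    case True
    have "d'' (component p q z) = 0" using z component_d''[of p "q + 1" z] by simp
    then show ?thesis
      using dd_halfD[OF assms[OF True], of "component (p - 1) q x"] component_A[of p q z] x by simp
  next
    case False
    then show ?thesis using z subspace_0[OF subspace_range_d'_d''] by (simp add: total_part_iff)
  qed
  then show "z \<in> range (d' \<circ> d'')"
    by (subst sum_components[OF decomposition(2)[of z] order_refl])
      (auto intro!: subspace_sum[OF subspace_range_d'_d''] simp del: comp_apply)
qed

end

section \<open>The same comparisons for the total cohomology\<close>

context bounded_double_complex
begin

lemma dd_total_partD:
  assumes "\<forall>p q. p + q = k \<longrightarrow> dd_lemma_at A d' d'' p q"
  shows "d'' (d' x) = 0 \<Longrightarrow> d' x \<in> total_part scale A k \<Longrightarrow> d' x \<in> range (d' \<circ> d'')"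
    and "d' (d'' x) = 0 \<Longrightarrow> d'' x \<in> total_part scale A k \<Longrightarrow> d'' x \<in> range (d' \<circ> d'')"
proof -
  interpret swap: bounded_double_complex scale "\<lambda>p q. A q p" d'' d'
    by (rule bounded_double_complex_swap)
  have 1: "dd_half A d' d'' p q" if "p + q = k" for p q using assms that by (simp add: dd_lemma_at_iff)
  have 2: "dd_half (\<lambda>p q. A q p) d'' d' p q" if "p + q = k" for p q
    using assms[rule_format, of q p] that by (simp add: dd_lemma_at_iff)
  show "d'' (d' x) = 0 \<Longrightarrow> d' x \<in> total_part scale A k \<Longrightarrow> d' x \<in> range (d' \<circ> d'')"
    using dd_half_total_part[OF 1] by blast
  show "d' (d'' x) = 0 \<Longrightarrow> d'' x \<in> total_part scale A k \<Longrightarrow> d'' x \<in> range (d' \<circ> d'')"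
    using swap.dd_half_total_part[OF 2] unfolding total_part_swap range_d''_d' by blast
qed

text \<open>For a d-closed \<open>x\<close> one has \<open>d'' x = - d' x\<close>, so a single
  \<open>y\<close> with \<open>d' x = d' (d'' y)\<close> corrects both differentials at once:
  \<open>x - total_d d' d'' y\<close> is annihilated by each.\<close>

lemma BC_to_d_surj:
  assumes "\<forall>p q. p + q = k + 1 \<longrightarrow> dd_lemma_at A d' d'' p q"
  shows "{x. total_d d' d'' x = 0} \<inter> total_part scale A k \<subseteq>
    {x. d' x = 0} \<inter> {x. d'' x = 0} \<inter> total_part scale A k + total_d d' d'' ` total_part scale A (k - 1)"
proof
  fix x assume x: "x \<in> {x. total_d d' d'' x = 0} \<inter> total_part scale A k"
  then have c: "d'' x = - d' x" "d' (d'' x) = 0" using total_d_closedD[of x] by auto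
  have xT: "d' x \<in> total_part scale A (k + 1)" using x d'_total_part by blast
  then have "d' x \<in> range (d' \<circ> d'')" using dd_total_partD(1)[OF assms] c by simp
  then obtain y where y: "y \<in> total_part scale A (k - 1)" "d' x = d' (d'' y)"
    using range_d'_d''_total_part[OF _ xT] by auto
  have "x - total_d d' d'' y \<in> {x. d' x = 0} \<inter> {x. d'' x = 0} \<inter> total_part scale A k"
    using x y c total_d_total_part[OF y(1), of k] subspace_diff[OF subspace_total_part]
    by (auto simp: total_d_def)
  then have "(x - total_d d' d'' y) + total_d d' d'' y \<in>
    {x. d' x = 0} \<inter> {x. d'' x = 0} \<inter> total_part scale A k + total_d d' d'' ` total_part scale A (k - 1)"
    using y(1) by (intro set_plus_intro) auto
  then show "x \<in> {x. d' x = 0} \<inter> {x. d'' x = 0} \<inter> total_part scale A k +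
      total_d d' d'' ` total_part scale A (k - 1)" by simp
qed

lemma BC_to_d_inj:
  assumes "\<forall>p q. p + q = k \<longrightarrow> dd_lemma_at A d' d'' p q"
  shows "{x. d' x = 0} \<inter> {x. d'' x = 0} \<inter> total_part scale A k \<inter> total_d d' d'' ` total_part scale A (k - 1)
    \<subseteq> range (d' \<circ> d'') \<inter> total_part scale A k"
proof
  fix z assume z: "z \<in> {x. d' x = 0} \<inter> {x. d'' x = 0} \<inter> total_part scale A k \<inter> total_d d' d'' ` total_part scale A (k - 1)"
  then obtain x where x: "x \<in> total_part scale A (k - 1)" "z = d' x + d'' x" by (auto simp: total_d_def)
  have 0: "d' (d'' x) = 0" using z x(2) by simp
  have "d' x \<in> range (d' \<circ> d'')" "d'' x \<in> range (d' \<circ> d'')"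
    using dd_total_partD(1)[OF assms _ d'_total_part[OF x(1)]] dd_total_partD(2)[OF assms 0 d''_total_part[OF x(1)]] 0
    by (auto simp del: comp_apply)
  then have "z \<in> range (d' \<circ> d'')"
    unfolding x(2) by (rule subspace_add[OF subspace_range_d'_d''])
  then show "z \<in> range (d' \<circ> d'') \<inter> total_part scale A k" using z by blast
qed

text \<open>For \<open>z = d' x\<close> with \<open>x\<close> homogeneous, \<open>z\<close> is the
  component at \<open>(p, q)\<close> of the exact element \<open>total_d d' d'' x\<close>, which
  both differentials kill. Injectivity puts that element into the image of
  \<open>d' \<circ> d''\<close>, and projecting does the same for \<open>z\<close>.\<close>

lemma BC_to_d_injD:
  assumes inj: "{x. d' x = 0} \<inter> {x. d'' x = 0} \<inter> total_part scale A k \<inter> total_d d' d'' ` total_part scale A (k - 1)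
    \<subseteq> range (d' \<circ> d'') \<inter> total_part scale A k" and pq: "p + q = k"
  shows "dd_half A d' d'' p q"
  unfolding dd_half_def
proof
  fix z assume z: "z \<in> range d' \<inter> {x. d'' x = 0} \<inter> A p q"
  then obtain x where x: "x \<in> A (p - 1) q" "z = d' x" using range_d'_A[of p q] by auto
  have xT: "x \<in> total_part scale A (k - 1)" using x pq by (intro A_total_part) auto
  have 0: "d' (d'' x) = 0" using z x d''_d'[of x] by simp
  then have "d' (total_d d' d'' x) = 0" "d'' (total_d d' d'' x) = 0" by (simp_all add: total_d_def)
  then have "total_d d' d'' x \<in> range (d' \<circ> d'')"
    using inj xT total_d_total_part[OF xT, of k] by auto
  then obtain y where y: "total_d d' d'' x = d' (d'' y)" by auto
  have "component p q (d'' x) = 0" using x(1) by (simp add: component_homogeneous)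
  then have "component p q (total_d d' d'' x) = z" using z x(2) by (auto simp: total_d_def simp del: component_d' component_d'')
  then have "z = d' (d'' (component (p - 1) (q - 1) y))" using y by simp
  then show "z \<in> range (d' \<circ> d'')" by simp
qed

lemma d_to_A_inj:
  assumes "\<forall>p q. p + q = k \<longrightarrow> dd_lemma_at A d' d'' p q"
  shows "{x. total_d d' d'' x = 0} \<inter> total_part scale A k \<inter> ((range d' + range d'') \<inter> total_part scale A k)
    \<subseteq> total_d d' d'' ` total_part scale A (k - 1)"
proof
  fix x assume x: "x \<in> {x. total_d d' d'' x = 0} \<inter> total_part scale A k \<inter> ((range d' + range d'') \<inter> total_part scale A k)"
  then obtain u v where uv: "u \<in> total_part scale A (k - 1)" "v \<in> total_part scale A (k - 1)" "x = d' u + d'' v"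
    using range_sum_total_part by blast
  \<comment> \<open>Rewrites \<open>d' u + d'' v\<close> as an exact element plus
    \<open>d' w\<close>, so that the defect from exactness sits in a single
    \<open>d'\<close>-image.\<close>
  define w where "w = u - v"
  have w: "w \<in> total_part scale A (k - 1)" using uv subspace_diff[OF subspace_total_part] by (simp add: w_def)
  have xw: "x = total_d d' d'' v + d' w" by (simp add: uv w_def total_d_def)
  have "d'' (d' w) = total_d d' d'' x" unfolding xw by (simp add: total_d_def)
  then have "d'' (d' w) = 0" using x by simp
  then have "d' w \<in> range (d' \<circ> d'')"
    using dd_total_partD(1)[OF assms, where x = w] d'_total_part[OF w, of k] by simp
  then obtain y where y: "y \<in> total_part scale A (k - 2)" "d' w = d' (d'' y)"
    using range_d'_d''_total_part[of "d' w" k] d'_total_part[OF w, of k] by auto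
  have "x = total_d d' d'' (v + d'' y)" by (simp add: xw y total_d_def)
  moreover have "v + d'' y \<in> total_part scale A (k - 1)"
    using uv d''_total_part[OF y(1), of "k - 1"] subspace_add[OF subspace_total_part] by simp
  ultimately show "x \<in> total_d d' d'' ` total_part scale A (k - 1)" by blast
qed

lemma d_to_A_surj:
  assumes "\<forall>p q. p + q = k + 1 \<longrightarrow> dd_lemma_at A d' d'' p q"
  shows "{x. (d' \<circ> d'') x = 0} \<inter> total_part scale A k \<subseteq>
    {x. total_d d' d'' x = 0} \<inter> total_part scale A k + (range d' + range d'') \<inter> total_part scale A k"
proof
  fix x assume x: "x \<in> {x. (d' \<circ> d'') x = 0} \<inter> total_part scale A k"
  have T: "d' x \<in> total_part scale A (k + 1)" "d'' x \<in> total_part scale A (k + 1)"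
    using x d'_total_part d''_total_part by blast+
  have R: "d' x \<in> range (d' \<circ> d'')" "d'' x \<in> range (d' \<circ> d'')"
    using dd_total_partD(1)[OF assms _ T(1)] dd_total_partD(2)[OF assms _ T(2)] x by auto
  obtain y where y: "y \<in> total_part scale A (k - 1)" "d' x = d' (d'' y)"
    using range_d'_d''_total_part[OF R(1) T(1)] by auto
  obtain z where z: "z \<in> total_part scale A (k - 1)" "d'' x = d' (d'' z)"
    using range_d'_d''_total_part[OF R(2) T(2)] by auto
  \<comment> \<open>Chosen so that \<open>d' ?b = d' (d'' y) = d' x\<close> and
    \<open>d'' ?b = d' (d'' z) = d'' x\<close>; hence both differentials kill
    \<open>x - ?b\<close>.\<close>
  let ?b = "d' (- z) + d'' y"
  have b: "?b \<in> (range d' + range d'') \<inter> total_part scale A k"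
    using d'_total_part[OF subspace_neg[OF subspace_total_part z(1)], of k] d''_total_part[OF y(1), of k]
    by (intro IntI set_plus_intro rangeI subspace_add[OF subspace_total_part]) auto
  have "total_d d' d'' (x - ?b) = 0" using y(2) z(2) by (simp add: total_d_def)
  then have "(x - ?b) + ?b \<in> {x. total_d d' d'' x = 0} \<inter> total_part scale A k + (range d' + range d'') \<inter> total_part scale A k"
    using x b subspace_diff[OF subspace_total_part] by (intro set_plus_intro) auto
  then show "x \<in> {x. total_d d' d'' x = 0} \<inter> total_part scale A k + (range d' + range d'') \<inter> total_part scale A k"
    by simp
qed

text \<open>Homogeneity of \<open>w\<close> is used in two neighbouring bidegrees. At
  \<open>(p, q - 1)\<close> the equation \<open>w = c + (d' u + d'' v)\<close> has zero left side
  and expresses that component of \<open>c\<close> through \<open>u\<close> and \<open>v\<close>;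
  closedness of \<open>c\<close> transfers this to \<open>d'\<close> of its component at
  \<open>(p - 1, q)\<close>, where the left side is \<open>w\<close>. So \<open>z\<close> is
  \<open>d' \<circ> d''\<close> of the component of \<open>v - u\<close> at
  \<open>(p - 1, q - 1)\<close>.\<close>

lemma d_to_A_surjD:
  assumes surj: "{x. (d' \<circ> d'') x = 0} \<inter> total_part scale A k \<subseteq>
      {x. total_d d' d'' x = 0} \<inter> total_part scale A k + (range d' + range d'') \<inter> total_part scale A k"
    and pq: "p + q = k + 1"
  shows "dd_half A d' d'' p q"
  unfolding dd_half_def
proof
  fix z assume z: "z \<in> range d' \<inter> {x. d'' x = 0} \<inter> A p q"
  then obtain w where w: "w \<in> A (p - 1) q" "z = d' w" using range_d'_A[of p q] by auto
  have "w \<in> total_part scale A k" using w pq by (intro A_total_part) auto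
  moreover have "d' (d'' w) = 0" using z w d''_d'[of w] by simp
  ultimately have "w \<in> {x. total_d d' d'' x = 0} \<inter> total_part scale A k + (range d' + range d'') \<inter> total_part scale A k"
    using surj by auto
  then obtain c u v where c: "total_d d' d'' c = 0" "w = c + (d' u + d'' v)"
    by (auto elim!: set_plus_elim)
  let ?c = "\<lambda>p q. component p q c" and ?u = "\<lambda>p q. component p q u" and ?v = "\<lambda>p q. component p q v"
  have "component p q (total_d d' d'' c) = 0" using c(1) by simp
  then have 1: "d' (?c (p - 1) q) = - d'' (?c p (q - 1))"
    by (simp add: total_d_def eq_neg_iff_add_eq_0)
  have "?c p (q - 1) + (d' (?u (p - 1) (q - 1)) + d'' (?v p (q - 1 - 1))) = component p (q - 1) w"
    using c(2) by simp
  also have "\<dots> = 0" using w(1) by (simp add: component_homogeneous)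
  finally have "?c p (q - 1) = - (d' (?u (p - 1) (q - 1)) + d'' (?v p (q - 1 - 1)))"
    by (rule eq_neg_iff_add_eq_0[THEN iffD2])
  then have 2: "d'' (?c p (q - 1)) = d' (d'' (?u (p - 1) (q - 1)))" by simp
  have "w = component (p - 1) q w" using w(1) by simp
  also have "\<dots> = ?c (p - 1) q + (d' (?u (p - 1 - 1) q) + d'' (?v (p - 1) (q - 1)))"
    using c(2) by simp
  finally have "z = d' (?c (p - 1) q) + d' (d'' (?v (p - 1) (q - 1)))"
    using w(2) by simp
  also have "\<dots> = (d' \<circ> d'') (?v (p - 1) (q - 1) - ?u (p - 1) (q - 1))"
    by (simp add: 1 2)
  finally show "z \<in> range (d' \<circ> d'')" by (simp only: rangeI)
qed

end

section \<open>Finiteness\<close>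

context double_complex
begin

text \<open>Exactness of \<open>H_BC(p, q) \<rightarrow> H_d'(p, q) \<rightarrow> H_BC(p, q +
  1)\<close>, the second map being induced by \<open>d''\<close>.\<close>

lemma finite_d'_of_BC:
  assumes "finite_mod ({x. d' x = 0} \<inter> {x. d'' x = 0} \<inter> A p q) (range (d' \<circ> d'') \<inter> A p q)"
    and "finite_mod ({x. d' x = 0} \<inter> {x. d'' x = 0} \<inter> A p (q + 1)) (range (d' \<circ> d'') \<inter> A p (q + 1))"
  shows "finite_mod ({x. d' x = 0} \<inter> A p q) (d' ` A (p - 1) q)"
proof -
  let ?Z = "{x. d' x = 0} \<inter> A p q" and ?R = "range (d' \<circ> d'') \<inter> A p (q + 1)"
  have sub: "d'' ` ?Z \<subseteq> {x. d' x = 0} \<inter> {x. d'' x = 0} \<inter> A p (q + 1)"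
  proof
    fix y assume "y \<in> d'' ` ?Z"
    then obtain x where "y = d'' x" "x \<in> A p q" "d' x = 0" by blast
    then show "y \<in> {x. d' x = 0} \<inter> {x. d'' x = 0} \<inter> A p (q + 1)"
      using d''_d'[of x] d''_A[of x p q] by simp
  qed
  have "finite_mod (d'' ` ?Z) ?R"
    using assms(2) sub order_refl by (rule finite_mod_mono)
  then have "finite_mod ?Z {x \<in> ?Z. d'' x \<in> ?R}"
    by (intro finite_mod_vimage linear_d'' subspaces)
  moreover have "{x \<in> ?Z. d'' x \<in> ?R} \<subseteq> {x. d' x = 0} \<inter> {x. d'' x = 0} \<inter> A p q + d' ` A (p - 1) q"
    using kernel_d'_with_exact_d'' by blast
  moreover have "range (d' \<circ> d'') \<inter> A p q \<subseteq> d' ` A (p - 1) q"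
    unfolding range_d'_A[symmetric] by auto
  then have "finite_mod ({x. d' x = 0} \<inter> {x. d'' x = 0} \<inter> A p q + d' ` A (p - 1) q) (d' ` A (p - 1) q)"
    using finite_mod_mono[OF assms(1) order_refl] by (intro finite_mod_plus_right) auto
  ultimately show ?thesis by (meson finite_mod_mono finite_mod_trans order_refl)
qed

text \<open>Exactness of \<open>H_A(p, q - 1) \<rightarrow> H_d'(p, q) \<rightarrow> H_A(p,
  q)\<close>, the first map being induced by \<open>d''\<close>: if \<open>d' u + d'' v\<close> is
  \<open>d'\<close>-closed, then \<open>v\<close> is a cycle for Aeppli cohomology.\<close>

lemma finite_d'_of_A:
  assumes "finite_mod ({x. (d' \<circ> d'') x = 0} \<inter> A p q) ((range d' + range d'') \<inter> A p q)"
    and "finite_mod ({x. (d' \<circ> d'') x = 0} \<inter> A p (q - 1)) ((range d' + range d'') \<inter> A p (q - 1))"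
  shows "finite_mod ({x. d' x = 0} \<inter> A p q) (d' ` A (p - 1) q)"
proof -
  let ?Z = "{x. d' x = 0} \<inter> A p q" and ?B = "(range d' + range d'') \<inter> A p q"
  let ?K = "{x. (d' \<circ> d'') x = 0} \<inter> A p (q - 1)"
  have sub: "?Z \<subseteq> {x. (d' \<circ> d'') x = 0} \<inter> A p q"
  proof
    fix x assume "x \<in> ?Z"
    then show "x \<in> {x. (d' \<circ> d'') x = 0} \<inter> A p q" using d''_d'[of x] by simp
  qed
  have "finite_mod ?Z ?B"
    using assms(1) sub order_refl by (rule finite_mod_mono)
  then have 1: "finite_mod ?Z (?Z \<inter> ?B)" by (intro finite_mod_Int subspaces)
  have 2: "?Z \<inter> ?B \<subseteq> d' ` A (p - 1) q + d'' ` ?K"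
  proof
    fix x assume x: "x \<in> ?Z \<inter> ?B"
    then obtain u v where uv: "x = d' u + d'' v" "u \<in> A (p - 1) q" "v \<in> A p (q - 1)"
      unfolding range_sum_A by (auto elim!: set_plus_elim)
    then show "x \<in> d' ` A (p - 1) q + d'' ` ?K" using x by (auto intro!: set_plus_intro imageI)
  qed
  have "d'' ` ((range d' + range d'') \<inter> A p (q - 1)) \<subseteq> range d' \<inter> A p q"
  proof
    fix x assume "x \<in> d'' ` ((range d' + range d'') \<inter> A p (q - 1))"
    then obtain u v where uv: "x = d'' (d' u + d'' v)" "d' u + d'' v \<in> A p (q - 1)"
      by (auto elim!: set_plus_elim)
    have "x \<in> A p q" using d''_A[OF uv(2)] uv(1) by simp
    moreover have "x = d' (d'' (- u))" using uv(1) by simp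
    ultimately show "x \<in> range d' \<inter> A p q" by blast
  qed
  then have "finite_mod (d'' ` ?K) (d' ` A (p - 1) q)"
    using finite_mod_mono[OF finite_mod_image[OF linear_d'' assms(2)] order_refl] by (simp add: range_d'_A)
  from finite_mod_plus_left[OF this]
  show ?thesis using 1 2 by (meson finite_mod_mono finite_mod_trans order_refl)
qed

lemma component_swap: "double_complex.component (\<lambda>p q. A q p) q p = component p q"
proof
  fix x
  interpret swap: double_complex scale "\<lambda>p q. A q p" d'' d' by (rule double_complex_swap)
  let ?I = "{i. decomposition x i \<noteq> 0}"
  have x: "x = (\<Sum>(r, s)\<in>?I. component r s x)" by (rule sum_components[OF decomposition(2)]) simp
  have "swap.component q p (component r s x) = component p q (component r s x)" for r s
    using swap.component_homogeneous[of "component r s x" r s q p] component_A[of r s x] by auto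
  then have "swap.component q p (\<Sum>(r, s)\<in>?I. component r s x) = component p q (\<Sum>(r, s)\<in>?I. component r s x)"
    by (simp add: module_hom.sum[OF swap.module_hom_component] module_hom.sum[OF module_hom_component]
        case_prod_beta del: component_component)
  then show "swap.component q p x = component p q x" using x by simp
qed

lemma component_total_d: "component p q (total_d d' d'' x) = d' (component (p - 1) q x) + d'' (component p (q - 1) x)"
  by (simp add: total_d_def)

lemma subspace_components: "subspace {x. \<forall>r s. P r s \<longrightarrow> component (f r s) (g r s) x = 0}"
  by (auto simp: subspace_def)

lemma subspace_components_total_d:
  "subspace {x. \<forall>r s. P r s \<longrightarrow> component (f r s) (g r s) (total_d d' d'' x) = 0}"
  using module_hom.subspace_linear_preimage[OF linear_total_d[folded module_hom_iff_linear]
      subspace_components[of P f g]] by simp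

end

section \<open>Filtration and staircase arguments\<close>

context bounded_double_complex
begin

lemma support_bound: obtains N where "\<And>p q x. p < - N \<Longrightarrow> component p q x = 0" "\<And>p q x. p > N \<Longrightarrow> component p q x = 0"
proof -
  obtain N where N: "\<And>p. p \<in> support \<Longrightarrow> \<bar>p\<bar> \<le> N"
    using finite_support by (metis abs_le_iff finite_imageI finite_int_iff_bounded_le imageI atMost_iff subsetD)
  show ?thesis
  proof (rule that[of N])
    show "component p q x = 0" if "p < - N" for p q x
      using N[of p] component_outside_support[of p q x] that by linarith
    show "component p q x = 0" if "p > N" for p q x
      using N[of p] component_outside_support[of p q x] that by linarith
  qed
qed

text \<open>The classes are filtered by the largest \<open>p\<close> with a nonzero component; that component is
  \<open>d'\<close>-closed.\<close>

lemma finite_d_of_d':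
  assumes fin: "\<And>p q. p + q = k \<Longrightarrow> finite_mod ({x. d' x = 0} \<inter> A p q) (d' ` A (p - 1) q)"
  shows "finite_mod ({x. total_d d' d'' x = 0} \<inter> total_part scale A k) (total_d d' d'' ` total_part scale A (k - 1))"
proof -
  let ?B = "total_d d' d'' ` total_part scale A (k - 1)"
  define F where "F m = {x. total_d d' d'' x = 0} \<inter> total_part scale A k \<inter> {x. \<forall>p q. m < p \<longrightarrow> component p q x = 0}" for m
  have subF: "subspace (F m)" for m
    unfolding F_def by (intro subspaces subspace_components)
  obtain N where N: "\<And>p q x. p < - N \<Longrightarrow> component p q x = 0" "\<And>p q x. p > N \<Longrightarrow> component p q x = 0"
    using support_bound by blast
  have step: "finite_mod (F m) ?B" if IH: "finite_mod (F (m - 1)) ?B" for m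
  proof -
    let ?c = "component m (k - m)"
    \<comment> \<open>In bidegree \<open>(m + 1, k - m)\<close> closedness of \<open>x\<close> says
      that \<open>d'\<close> kills the leading component, since \<open>x\<close> has no component in
      column \<open>m + 1\<close>.\<close>
    have "?c ` F m \<subseteq> {x. d' x = 0} \<inter> A m (k - m)"
    proof
      fix y assume "y \<in> ?c ` F m"
      then obtain x where x: "y = ?c x" "x \<in> F m" by blast
      then have "component (m + 1) (k - m) (total_d d' d'' x) = 0" "component (m + 1) (k - m - 1) x = 0"
        by (simp_all add: F_def)
      then have "d' y = 0" by (simp add: component_total_d x(1))
      then show "y \<in> {x. d' x = 0} \<inter> A m (k - m)" using x(1) component_A by simp
    qed
    then have "finite_mod (?c ` F m) (d' ` A (m - 1) (k - m))"
      using finite_mod_mono[OF fin[of m "k - m"] _ order_refl] by simp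
    then have "finite_mod (F m) {x \<in> F m. ?c x \<in> d' ` A (m - 1) (k - m)}"
      by (intro finite_mod_vimage linear_component subF subspaces)
    moreover have "{x \<in> F m. ?c x \<in> d' ` A (m - 1) (k - m)} \<subseteq> F (m - 1) + ?B"
    proof
      fix x assume "x \<in> {x \<in> F m. ?c x \<in> d' ` A (m - 1) (k - m)}"
      then obtain y where x: "x \<in> F m" and y: "y \<in> A (m - 1) (k - m)" "?c x = d' y" by blast
      have yT: "y \<in> total_part scale A (k - 1)" using y(1) by (rule A_total_part) simp
      have xT: "x - total_d d' d'' y \<in> total_part scale A k"
        using x total_d_total_part[OF yT, of k] subspace_diff[OF subspace_total_part] by (simp add: F_def)
      \<comment> \<open>Subtracting the differential of \<open>y\<close> removes the leading
        component and creates nothing in columns beyond \<open>m\<close>, since \<open>y\<close>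
        lies in column \<open>m - 1\<close>.\<close>
      have "component p q (x - total_d d' d'' y) = 0" if "m - 1 < p" for p q
      proof (cases "p = m \<and> q = k - m")
        case True
        have "component m (k - m - 1) y = 0" using y(1) by (simp add: component_homogeneous)
        then show ?thesis using True y by (simp add: component_total_d)
      next
        case False
        show ?thesis
        proof (cases "p = m")
          case True
          then show ?thesis using False xT unfolding total_part_iff by (auto simp del: component_simps)
        next
          case False
          then have "m < p" using that by simp
          then show ?thesis using x component_homogeneous[OF y(1)] by (simp add: component_total_d F_def)
        qed
      qed
      then have "x - total_d d' d'' y \<in> F (m - 1)" using x xT by (simp add: F_def)
      then have "(x - total_d d' d'' y) + total_d d' d'' y \<in> F (m - 1) + ?B"
        using yT by (intro set_plus_intro imageI)
      then show "x \<in> F (m - 1) + ?B" by simp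
    qed
    moreover have "finite_mod (F (m - 1) + ?B) ?B"
      using IH by (rule finite_mod_plus_right)
    ultimately show ?thesis by (meson finite_mod_mono finite_mod_trans order_refl)
  qed
  have "F (- N - 1) \<subseteq> {0}"
  proof
    fix x assume "x \<in> F (- N - 1)"
    then have "component p q x = 0" for p q using N(1)[of p q x] by (cases "p < - N") (auto simp: F_def)
    then show "x \<in> {0}" using eq_componentsI[of x 0] by simp
  qed
  moreover have "0 \<in> ?B" by (intro subspace_0 subspaces)
  ultimately have base: "finite_mod (F (- N - 1)) ?B" by (intro finite_mod_subset) auto
  have all: "finite_mod (F m) ?B" if "m \<ge> - N - 1" for m
    using that
  proof (induction rule: int_ge_induct)
    case (step i)
    then show ?case using \<open>\<And>m. finite_mod (F (m - 1)) ?B \<Longrightarrow> finite_mod (F m) ?B\<close>[of "i + 1"] by simp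
  qed (rule base)
  \<comment> \<open>The maximum guards against a negative \<open>N\<close>, which may lie below the
    start \<open>- N - 1\<close> of the induction.\<close>
  have "{x. total_d d' d'' x = 0} \<inter> total_part scale A k = F (max N (- N - 1))"
    using N(2) by (auto simp: F_def)
  then show ?thesis using all[of "max N (- N - 1)"] by simp
qed

text \<open>Call the set on the left \<open>E j\<close>.  Splitting off the last component of \<open>x\<close> gives
  \<open>E (j + 1) = d' {x. d'' x \<in> E j}\<close>, which drives an induction on \<open>j\<close>.\<close>

lemma finite_BC_mod_exact_lower:
  assumes fin: "\<And>p q. p + q = k - 1 \<Longrightarrow> finite_mod ({x. d'' x = 0} \<inter> A p q) (d'' ` A p (q - 1))"
  shows "finite_mod (total_d d' d'' ` (total_part scale A (k - 1) \<inter> {x. \<forall>p q. p \<ge> j \<longrightarrow> component p q x = 0}) \<inter> A j (k - j))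
    (range (d' \<circ> d''))"
proof -
  define E where "E j = total_d d' d'' ` (total_part scale A (k - 1) \<inter> {x. \<forall>p q. p \<ge> j \<longrightarrow> component p q x = 0})
    \<inter> A j (k - j)" for j
  have subE: "subspace (E j)" for j
    unfolding E_def by (intro subspaces subspace_components)
  obtain N where N: "\<And>p q x. p < - N \<Longrightarrow> component p q x = 0" by (rule support_bound) (rule that)
  have base: "finite_mod (E j) (range (d' \<circ> d''))" if "j \<le> - N" for j
  proof (rule finite_mod_subset)
    have "x = 0" if "\<And>p q. p \<ge> j \<Longrightarrow> component p q x = 0" for x
    proof (rule eq_componentsI)
      show "component p q x = component p q 0" for p q
        using that[of p q] N[of p q x] \<open>j \<le> - N\<close> by (cases "p \<ge> j") simp_all
    qed
    then have "E j \<subseteq> total_d d' d'' ` {0}" unfolding E_def by blast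
    then have "E j \<subseteq> {0}" by simp
    then show "E j \<subseteq> range (d' \<circ> d'')" using subspace_0[OF subspace_range_d'_d''] by blast
  qed
  have step: "finite_mod (E (j + 1)) (range (d' \<circ> d''))" if IH: "finite_mod (E j) (range (d' \<circ> d''))" for j
  proof -
    let ?A = "A j (k - 1 - j)"
    define M where "M = ?A \<inter> {x. d'' x \<in> E j}"
    have subM: "subspace M"
      unfolding M_def by (intro subspaces module_hom.subspace_linear_preimage[OF module_hom_d''] subE)
    have "finite_mod (d'' ` M) (range (d' \<circ> d''))"
      by (rule finite_mod_mono[OF IH _ order_refl]) (auto simp: M_def)
    then have "finite_mod M {x \<in> M. d'' x \<in> range (d' \<circ> d'')}"
      by (intro finite_mod_vimage linear_d'' subM subspaces)
    \<comment> \<open>If \<open>d'' x = d' (d'' y)\<close>, then \<open>x + d' y\<close> is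
      \<open>d''\<close>-closed of degree \<open>k - 1\<close>; this is where finiteness of
      \<open>H_d''\<close> enters.\<close>
    moreover have "{x \<in> M. d'' x \<in> range (d' \<circ> d'')} \<subseteq> ({x. d'' x = 0} \<inter> ?A) + range d'"
    proof
      fix x assume x: "x \<in> {x \<in> M. d'' x \<in> range (d' \<circ> d'')}"
      then have xA: "x \<in> ?A" by (simp add: M_def)
      then have "d'' x \<in> A j (k - 1 - j + 1)" by (rule d''_A)
      moreover have "d'' x \<in> range (d' \<circ> d'')" using x by blast
      ultimately obtain y where "y \<in> A (j - 1) (k - 1 - j + 1 - 1)" and y2: "d'' x = d' (d'' y)"
        by (metis range_d'_d''_obtain)
      then have y: "y \<in> A (j - 1) (k - 1 - j)" by (simp only: add_diff_cancel_right')
      have "(x + d' y) + d' (- y) \<in> ({x. d'' x = 0} \<inter> ?A) + range d'"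
        using y2 xA d'_A[OF y] subspace_add[OF subspace_A] by (intro set_plus_intro rangeI) auto
      then show "x \<in> ({x. d'' x = 0} \<inter> ?A) + range d'" by simp
    qed
    moreover have "finite_mod ({x. d'' x = 0} \<inter> ?A + range d') (range d'' + range d')"
    proof (rule finite_mod_plus)
      have sub: "range d' \<subseteq> range d'' + range d'" "range d'' \<subseteq> range d'' + range d'"
        using set_zero_plus2[OF subspace_0[OF subspace_range_d''], of "range d'"]
          set_zero_plus2[OF subspace_0[OF subspace_range_d'], of "range d''"] by (simp_all only: add.commute)
      have "d'' ` A j (k - 1 - j - 1) \<subseteq> range d'' + range d'" using sub(2) by blast
      then show "finite_mod (range d') (range d'' + range d')"
        "finite_mod ({x. d'' x = 0} \<inter> ?A) (range d'' + range d')"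
        using finite_mod_mono[OF fin[of j "k - 1 - j"] order_refl] finite_mod_subset[OF sub(1)] by simp_all
    qed
    ultimately have "finite_mod M (range d'' + range d')"
      by (meson finite_mod_mono finite_mod_trans order_refl)
    \<comment> \<open>Since \<open>d'\<close> squares to zero, it maps
      \<open>range d'' + range d'\<close> into \<open>range (d' \<circ> d'')\<close>; applied to
      \<open>M\<close>, this gives the bound on \<open>E (j + 1)\<close>.\<close>
    moreover have "d' ` (range d'' + range d') \<subseteq> range (d' \<circ> d'')" by (auto elim!: set_plus_elim)
    ultimately have "finite_mod (d' ` M) (range (d' \<circ> d''))"
      using finite_mod_mono[OF finite_mod_image[OF linear_d'] order_refl] by blast
    moreover have "E (j + 1) \<subseteq> d' ` M"
    proof
      fix z assume "z \<in> E (j + 1)"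
      then obtain x where z: "z = total_d d' d'' x" "z \<in> A (j + 1) (k - (j + 1))"
        and x: "x \<in> total_part scale A (k - 1)" "\<And>p q. p \<ge> j + 1 \<Longrightarrow> component p q x = 0"
        by (auto simp: E_def)
      let ?x = "component j (k - 1 - j) x"
      have "component (j + 1) (k - (j + 1)) z = d' ?x"
        unfolding z(1) component_total_d using x(2) by (simp add: algebra_simps)
      then have zx: "z = d' ?x" using z(2) by simp
      have comp: "component p q (?x - x) = 0" if "p \<ge> j" for p q
        using x that unfolding total_part_iff by (cases "p = j"; cases "q = k - 1 - j") auto
      \<comment> \<open>As the differential of \<open>x\<close> is \<open>z = d' ?x\<close>, the
        remaining term \<open>d'' ?x\<close> of the differential of \<open>?x\<close> is exact with
        primitive \<open>?x - x\<close>, which has no component in columns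
        \<open>\<ge> j\<close>.\<close>
      have D: "d'' ?x = total_d d' d'' (?x - x)" using zx z(1) by (simp add: total_d_def algebra_simps)
      have T: "?x - x \<in> total_part scale A (k - 1)"
        using x(1) A_total_part[OF component_A, of j "k - 1 - j"] subspace_diff[OF subspace_total_part] by simp
      have "d'' ?x \<in> A j (k - j)" using d''_A[OF component_A, of j "k - 1 - j"] by simp
      then have "d'' ?x \<in> E j"
        unfolding E_def using comp by (intro IntI image_eqI[where f = "total_d d' d''", OF D] T CollectI allI impI)
      then have "?x \<in> M" unfolding M_def using component_A by (intro IntI CollectI)
      then show "z \<in> d' ` M" using zx by (rule rev_image_eqI)
    qed
    ultimately show ?thesis by (meson finite_mod_mono order_refl)
  qed
  have "finite_mod (E j) (range (d' \<circ> d''))"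
  proof (cases "j \<le> - N")
    case False
    then have "- N \<le> j" by simp
    then show ?thesis by (induction rule: int_ge_induct) (use base step in auto)
  qed (rule base)
  then show ?thesis by (simp add: E_def)
qed

lemma truncation:
  assumes "x \<in> total_part scale A k"
  obtains y where "y \<in> total_part scale A k"
    "\<And>s t. component s t y = (if s < p then component s t x else 0)"
proof
  let ?y = "\<Sum>r\<in>support. if r < p then component r (k - r) x else 0"
  have "component s t (if r < p then component r (k - r) x else 0) =
      (if r = s then if s < p \<and> s + t = k then component s t x else 0 else 0)" for r s t
    by auto
  then have y: "component s t ?y = (if s < p then component s t x else 0)" for s t
    using assms component_outside_support[of s t x] finite_support
    by (auto simp: module_hom.sum[OF module_hom_component] total_part_iff)
  then show "component s t ?y = (if s < p then component s t x else 0)" for s t .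
  show "?y \<in> total_part scale A k" using assms y by (auto simp: total_part_iff)
qed

text \<open>Finiteness of \<open>H_d\<close> reduces the claim to the d-exact elements of
  \<open>A p q\<close>. A primitive of such an element is cut at column \<open>p\<close>, and both
  pieces still have their differential in \<open>A p q\<close>. The piece in columns
  \<open>< p\<close> is covered by \<open>finite_BC_mod_exact_lower\<close>, the other one by the
  same lemma for the interchanged complex.\<close>

lemma finite_BC_of_d_d'_d'':
  assumes d': "\<And>p q. p + q = k - 1 \<Longrightarrow> finite_mod ({x. d' x = 0} \<inter> A p q) (d' ` A (p - 1) q)"
    and d'': "\<And>p q. p + q = k - 1 \<Longrightarrow> finite_mod ({x. d'' x = 0} \<inter> A p q) (d'' ` A p (q - 1))"
    and d: "finite_mod ({x. total_d d' d'' x = 0} \<inter> total_part scale A k) (total_d d' d'' ` total_part scale A (k - 1))"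
    and pq: "p + q = k"
  shows "finite_mod ({x. d' x = 0} \<inter> {x. d'' x = 0} \<inter> A p q) (range (d' \<circ> d'') \<inter> A p q)"
proof -
  interpret swap: bounded_double_complex scale "\<lambda>p q. A q p" d'' d'
    by (rule bounded_double_complex_swap)
  note swap.d''_d' [simp del] \<comment> \<open>loops together with \<open>d''_d'\<close>\<close>
  let ?T = "total_part scale A (k - 1)" and ?D = "total_d d' d''" and ?R = "range (d' \<circ> d'')"
  let ?Z = "{x. d' x = 0} \<inter> {x. d'' x = 0} \<inter> A p q"
  let ?E1 = "?D ` (?T \<inter> {x. \<forall>s t. p \<le> s \<longrightarrow> component s t x = 0}) \<inter> A p q"
  let ?E2 = "?D ` (?T \<inter> {x. \<forall>s t. q \<le> s \<longrightarrow> component t s x = 0}) \<inter> A p q"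
  have kpq: "k - p = q" "k - q = p" using pq by auto
  have E1: "finite_mod ?E1 ?R"
    using finite_BC_mod_exact_lower[where k = k and j = p] d'' by (simp only: kpq)
  have "finite_mod (total_d d'' d' ` (total_part scale (\<lambda>p q. A q p) (k - 1) \<inter>
      {x. \<forall>s t. q \<le> s \<longrightarrow> swap.component s t x = 0}) \<inter> A (k - q) q) (range (d'' \<circ> d'))"
    by (rule swap.finite_BC_mod_exact_lower) (use d' in \<open>simp add: add.commute\<close>)
  then have E2: "finite_mod ?E2 ?R"
    by (simp only: kpq total_d_swap total_part_swap component_swap range_d''_d')
  have "?D ` ?T \<inter> A p q \<subseteq> ?E1 + ?E2"
  proof
    fix z assume "z \<in> ?D ` ?T \<inter> A p q"
    then obtain x where x: "x \<in> ?T" "z = ?D x" "z \<in> A p q" by blast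
    obtain y where y: "y \<in> ?T" "\<And>s t. component s t y = (if s < p then component s t x else 0)"
      using truncation[OF x(1)] by blast
    have DyT: "?D y \<in> total_part scale A k" using y(1) by (rule total_d_total_part) simp
    have yA: "?D y \<in> A p q"
      unfolding A_iff
    proof (intro allI impI)
      fix s t assume st: "s \<noteq> p \<or> t \<noteq> q"
      \<comment> \<open>Left of column \<open>p\<close> the truncation does not change the
        differential, and there \<open>z\<close> vanishes; right of it nothing is left; in column
        \<open>p\<close> the total degree decides.\<close>
      consider "s < p" | "s > p" | "s = p" "t \<noteq> q" using st by linarith
      then show "component s t (?D y) = 0"
      proof cases
        case 1
        then have "component s t (?D y) = component s t z" by (simp add: component_total_d y(2) x(2))
        then show ?thesis using 1 x(3) by (simp add: component_homogeneous)
      next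
        case 2
        then show ?thesis by (simp add: component_total_d y(2))
      next
        case 3
        then show ?thesis using DyT pq unfolding total_part_iff by auto
      qed
    qed
    have xyT: "x - y \<in> ?T" using x y by (intro subspace_diff[OF subspace_total_part])
    \<comment> \<open>In total degree \<open>k - 1 = p + q - 1\<close>, columns
      \<open>\<ge> p\<close> meet only rows \<open>< q\<close>.\<close>
    have "component t s (x - y) = 0" if "q \<le> s" for s t
    proof (cases "t < p")
      case False
      then have "t + s \<noteq> k - 1" using that pq by linarith
      then show ?thesis using xyT unfolding total_part_iff by blast
    qed (simp add: y(2))
    moreover have "?D (x - y) \<in> A p q" using yA x subspace_diff[OF subspace_A] by simp
    ultimately have "?D y + ?D (x - y) \<in> ?E1 + ?E2"
      using y yA xyT by (intro set_plus_intro IntI imageI CollectI allI impI) auto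
    then show "z \<in> ?E1 + ?E2" using x(2) by simp
  qed
  then have 1: "finite_mod (?D ` ?T \<inter> A p q) ?R"
    using finite_mod_mono[OF finite_mod_plus[OF E1 E2] _ order_refl] by blast
  have subZ: "subspace ?Z" by (intro subspaces)
  have "?Z \<subseteq> {x. ?D x = 0} \<inter> total_part scale A k"
    using kernel_sub(1) A_total_part[OF _ pq] by blast
  then have "finite_mod ?Z (?D ` ?T)" by (rule finite_mod_mono[OF d _ order_refl])
  then have "finite_mod ?Z (?Z \<inter> ?D ` ?T)" by (intro finite_mod_Int subspaces)
  then have "finite_mod ?Z ?R"
    by (rule finite_mod_trans) (rule finite_mod_mono[OF 1 _ order_refl], blast)
  then have "finite_mod ?Z (?Z \<inter> ?R)" by (intro finite_mod_Int subspaces)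
  then show ?thesis by (rule finite_mod_mono[OF _ order_refl]) blast
qed

text \<open>The elements on the right are those \<open>x\<close> that start a chain \<open>x = y\<^sub>0, y\<^sub>1, \<dots>\<close> with
  \<open>d' y\<^sub>i = - d'' y\<^sub>i\<^sub>+\<^sub>1\<close>.  An \<open>x\<close> that extends in both directions is a component of a \<open>d\<close>-closed
  element.\<close>

lemma finite_kernel_mod_right_extendable:
  assumes fin: "\<And>p q. p + q = k \<Longrightarrow> finite_mod ({x. d'' x = 0} \<inter> A p q) (d'' ` A p (q - 1))"
  shows "finite_mod ({x. d' (d'' x) = 0} \<inter> A p (k - 1 - p))
    (component p (k - 1 - p) ` (total_part scale A (k - 1) \<inter> {y. \<forall>r s. r < p \<longrightarrow> component r s y = 0}
      \<inter> {y. \<forall>r s. p < r \<longrightarrow> component r s (total_d d' d'' y) = 0}))"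
proof -
  define K where "K p = {x. d' (d'' x) = 0} \<inter> A p (k - 1 - p)" for p
  define Y where "Y p = total_part scale A (k - 1) \<inter> {y. \<forall>r s. r < p \<longrightarrow> component r s y = 0}
      \<inter> {y. \<forall>r s. p < r \<longrightarrow> component r s (total_d d' d'' y) = 0}" for p
  define X where "X p = component p (k - 1 - p) ` Y p" for p
  have subK: "subspace (K p)" for p
    unfolding K_def using subspaces(4) by (intro subspace_inter subspace_A) simp
  have "subspace (Y p)" for p
    unfolding Y_def by (intro subspaces subspace_components subspace_components_total_d)
  then have subX: "subspace (X p)" for p
    unfolding X_def by (rule module_hom.subspace_image[OF module_hom_component])
  obtain N where N: "\<And>p q x. p > N \<Longrightarrow> component p q x = 0" by (rule support_bound) (rule that)
  have base: "finite_mod (K p) (X p)" if "p > N" for p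
  proof (rule finite_mod_subset)
    have "K p \<subseteq> {0}" using N[OF that] component_same[of _ p "k - 1 - p"] by (auto simp: K_def)
    then show "K p \<subseteq> X p" using subspace_0[OF subX[of p]] by auto
  qed
  have step: "finite_mod (K p) (X p)" if IH: "finite_mod (K (p + 1)) (X (p + 1))" for p
  proof -
    let ?q = "k - 1 - p"
    have q: "k - 1 - (p + 1) = ?q - 1" by simp
    let ?B = "d'' ` A (p + 1) (?q - 1)"
    have "d' ` K p \<subseteq> {x. d'' x = 0} \<inter> A (p + 1) ?q"
      using d'_A by (auto simp: K_def)
    then have "finite_mod (d' ` K p) ?B"
      using finite_mod_mono[OF fin[of "p + 1" ?q] _ order_refl] by simp
    then have "finite_mod (d' ` K p) (d' ` K p \<inter> ?B)"
      by (intro finite_mod_Int subspaces subK)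
    \<comment> \<open>An element \<open>d'' y\<close> that equals some \<open>d' x\<close> is
      \<open>d'\<close>-closed, so \<open>y\<close> belongs to \<open>K (p + 1)\<close> and the
      induction hypothesis applies to it.\<close>
    moreover have "d' ` K p \<inter> ?B \<subseteq> d'' ` K (p + 1)"
    proof
      fix z assume "z \<in> d' ` K p \<inter> ?B"
      then obtain x y where "z = d' x" "z = d'' y" "y \<in> A (p + 1) (?q - 1)" by blast
      moreover from this have "d' (d'' y) = 0" by (metis d'_d')
      ultimately show "z \<in> d'' ` K (p + 1)" unfolding K_def q by blast
    qed
    moreover have "finite_mod (d'' ` K (p + 1)) (d'' ` X (p + 1))"
      using linear_d'' IH by (rule finite_mod_image)
    ultimately have "finite_mod (d' ` K p) (d'' ` X (p + 1))"
      by (meson finite_mod_mono finite_mod_trans order_refl)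
    then have "finite_mod (K p) {x \<in> K p. d' x \<in> d'' ` X (p + 1)}"
      by (intro finite_mod_vimage linear_d' subK subX subspaces)
    \<comment> \<open>If \<open>d' x\<close> is \<open>d''\<close> of the first term of a chain
      \<open>y\<close> starting in the next column, then \<open>x - y\<close> is a chain starting at
      \<open>x\<close>; the sign produces the alternating relation.\<close>
    moreover have "{x \<in> K p. d' x \<in> d'' ` X (p + 1)} \<subseteq> X p"
    proof
      fix x assume "x \<in> {x \<in> K p. d' x \<in> d'' ` X (p + 1)}"
      then obtain y where x: "x \<in> A p ?q" and y: "y \<in> Y (p + 1)" "d' x = d'' (component (p + 1) (?q - 1) y)"
        unfolding X_def K_def q by blast
      have yT: "y \<in> total_part scale A (k - 1)" and y0: "\<And>r s. r < p + 1 \<Longrightarrow> component r s y = 0"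
        and Dy: "\<And>r s. p + 1 < r \<Longrightarrow> component r s (total_d d' d'' y) = 0"
        using y(1) by (auto simp: Y_def)
      have xy: "x - y \<in> total_part scale A (k - 1)"
        using A_total_part[OF x, of "k - 1"] yT subspace_diff[OF subspace_total_part] by simp
      have DT: "total_d d' d'' (x - y) \<in> total_part scale A k" using xy by (rule total_d_total_part) simp
      have "component r s (total_d d' d'' (x - y)) = 0" if r: "p < r" for r s
      proof (cases "r + s = k")
        case True
        show ?thesis
        proof (cases "r = p + 1")
          case r: True
          then have s: "s = ?q" using True by simp
          show ?thesis using y0[of p] y(2) x by (simp add: component_total_d r s component_homogeneous[of x p ?q "p + 1"])
        next
          case False
          then have r: "p + 1 < r" using r by simp
          then show ?thesis
            using Dy[OF r, of s] component_homogeneous[OF x] by (simp add: component_total_d)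
        qed
      qed (use DT in \<open>auto simp only: total_part_iff\<close>)
      moreover have "component r s (x - y) = 0" if "r < p" for r s
        using y0[of r s] component_homogeneous[OF x, of r s] that by simp
      ultimately have "x - y \<in> Y p" using xy by (auto simp: Y_def simp del: total_d_simps component_simps)
      moreover have "component p ?q (x - y) = x" using x y0[of p] by simp
      ultimately show "x \<in> X p" unfolding X_def by (metis image_eqI)
    qed
    ultimately show ?thesis by (meson finite_mod_mono order_refl)
  qed
  have "finite_mod (K p) (X p)"
  proof (cases "p > N")
    case False
    then have "p \<le> N + 1" by simp
    then show ?thesis
    proof (induction rule: int_le_induct)
      case (step i)
      then show ?case using \<open>\<And>p. finite_mod (K (p + 1)) (X (p + 1)) \<Longrightarrow> finite_mod (K p) (X p)\<close>[of "i - 1"] by simp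
    qed (rule base, simp)
  qed (rule base)
  then show ?thesis unfolding K_def X_def Y_def .
qed

text \<open>Up to finite dimension, \<open>x\<close> starts a chain towards larger columns and, by
  symmetry, one towards larger rows. Glued at \<open>x\<close>, they form a d-closed element with
  component \<open>x\<close>. Finiteness of \<open>H_d\<close> bounds such components, because
  components of exact elements lie in \<open>range d' + range d''\<close>.\<close>

lemma finite_A_of_d_d'_d'':
  assumes d': "\<And>p q. p + q = k \<Longrightarrow> finite_mod ({x. d' x = 0} \<inter> A p q) (d' ` A (p - 1) q)"
    and d'': "\<And>p q. p + q = k \<Longrightarrow> finite_mod ({x. d'' x = 0} \<inter> A p q) (d'' ` A p (q - 1))"
    and d: "finite_mod ({x. total_d d' d'' x = 0} \<inter> total_part scale A (k - 1)) (total_d d' d'' ` total_part scale A (k - 2))"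
    and pq: "p + q = k - 1"
  shows "finite_mod ({x. (d' \<circ> d'') x = 0} \<inter> A p q) ((range d' + range d'') \<inter> A p q)"
proof -
  interpret swap: bounded_double_complex scale "\<lambda>p q. A q p" d'' d'
    by (rule bounded_double_complex_swap)
  note swap.d''_d' [simp del]
  let ?T = "total_part scale A (k - 1)" and ?D = "total_d d' d''"
  let ?K = "{x. d' (d'' x) = 0} \<inter> A p q"
  let ?Y1 = "?T \<inter> {y. \<forall>r s. r < p \<longrightarrow> component r s y = 0}
      \<inter> {y. \<forall>r s. p < r \<longrightarrow> component r s (?D y) = 0}"
  let ?Y2 = "?T \<inter> {y. \<forall>r s. r < q \<longrightarrow> component s r y = 0}
      \<inter> {y. \<forall>r s. q < r \<longrightarrow> component s r (?D y) = 0}"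
  let ?X1 = "component p q ` ?Y1" and ?X2 = "component p q ` ?Y2"
  have kpq: "k - 1 - p = q" "k - 1 - q = p" using pq by auto
  have K1: "finite_mod ?K ?X1"
    using finite_kernel_mod_right_extendable[where k = k and p = p] d'' by (simp only: kpq)
  have "finite_mod ({x. d'' (d' x) = 0} \<inter> A (k - 1 - q) q)
    (swap.component q (k - 1 - q) ` (total_part scale (\<lambda>p q. A q p) (k - 1) \<inter> {y. \<forall>r s. r < q \<longrightarrow> swap.component r s y = 0}
      \<inter> {y. \<forall>r s. q < r \<longrightarrow> swap.component r s (total_d d'' d' y) = 0}))"
    by (rule swap.finite_kernel_mod_right_extendable) (rule d', linarith)
  moreover have "{x. d'' (d' x) = 0} = {x. d' (d'' x) = 0}" by simp
  ultimately have K2: "finite_mod ?K ?X2"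
    by (simp only: kpq total_d_swap total_part_swap component_swap)
  let ?C = "component p q ` ({x. ?D x = 0} \<inter> ?T)"
  have subX1: "subspace ?X1" and subX2: "subspace ?X2"
    by (intro module_hom.subspace_image[OF module_hom_component] subspaces
        subspace_components subspace_components_total_d)+
  have "?X1 \<inter> ?X2 \<subseteq> ?C"
  proof
    fix x assume x: "x \<in> ?X1 \<inter> ?X2"
    then have xA: "x \<in> A p q" using component_A by blast
    obtain y where y': "x = component p q y" "y \<in> ?Y1" using IntD1[OF x] by (rule imageE)
    obtain w where w': "x = component p q w" "w \<in> ?Y2" using IntD2[OF x] by (rule imageE)
    have y: "y \<in> ?T" "component p q y = x" "\<And>r s. r < p \<Longrightarrow> component r s y = 0"
      "\<And>r s. p < r \<Longrightarrow> component r s (?D y) = 0" using y' by (simp_all del: component_simps total_d_simps)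
    have w: "w \<in> ?T" "component p q w = x" "\<And>r s. q < r \<Longrightarrow> component s r (?D w) = 0"
      "\<And>r s. r < q \<Longrightarrow> component s r w = 0" using w' by (simp_all del: component_simps total_d_simps)
    \<comment> \<open>Both chains contain \<open>x\<close>, so it is subtracted once.\<close>
    let ?c = "y + w - x"
    have cT: "?c \<in> ?T"
      using y(1) w(1) A_total_part[OF xA pq] by (intro subspace_add subspace_diff subspace_total_part)
    have DcT: "?D ?c \<in> total_part scale A k" using cT by (rule total_d_total_part) simp
    have wx: "component r s (w - x) = 0" if "p \<le> r" for r s
    proof (cases "r = p \<and> s = q")
      case True
      then show ?thesis using w(2) xA by simp
    next
      case False
      show ?thesis
      proof (cases "s < q")
        case True
        then show ?thesis using w(4)[of s r] component_homogeneous[OF xA, of r s] by simp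
      next
        case s: False
        then have "r + s \<noteq> k - 1" using False that pq by linarith
        moreover have "w - x \<in> ?T" using w(1) A_total_part[OF xA pq] by (intro subspace_diff subspace_total_part)
        ultimately show ?thesis unfolding total_part_iff by blast
      qed
    qed
    have yx: "component r s (y - x) = 0" if "r < p \<or> r = p \<and> s = q" for r s
      using y(2,3) xA that component_homogeneous[OF xA, of r s] by auto
    have "component r s (?D ?c) = 0" for r s
    proof (cases "r + s = k")
      case True
      \<comment> \<open>In columns beyond \<open>p\<close> only \<open>y\<close> contributes to the
        differential of \<open>?c\<close>; elsewhere in total degree \<open>k\<close> the row
        exceeds \<open>q\<close> and only \<open>w\<close> contributes.\<close>
      show ?thesis
      proof (cases "p < r")
        case r: True
        have "component r s (?D (w - x)) = 0"
          using wx[of "r - 1" s] wx[of r "s - 1"] r by (simp add: component_total_d del: component_simps total_d_simps)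
        moreover have "component r s (?D ?c) = component r s (?D y) + component r s (?D (w - x))"
          by (simp add: algebra_simps)
        ultimately show ?thesis using y(4)[OF r] by simp
      next
        case r: False
        then have s: "q < s" using True pq by linarith
        have "r - 1 < p" using r by simp
        moreover have "r < p \<or> r = p \<and> s - 1 = q" using r True pq by linarith
        ultimately have "component r s (?D (y - x)) = 0"
          using yx[of "r - 1" s] yx[of r "s - 1"] by (simp add: component_total_d del: component_simps total_d_simps)
        moreover have "component r s (?D ?c) = component r s (?D w) + component r s (?D (y - x))"
          by (simp add: algebra_simps)
        ultimately show ?thesis using w(3)[OF s] by simp
      qed
    qed (use DcT[unfolded total_part_iff] in blast)
    then have "?D ?c = 0" using eq_componentsI[of "?D ?c" 0] by simp
    moreover have "component p q ?c = x" using y(2) w(2) xA by simp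
    ultimately show "x \<in> ?C" using cT by (intro image_eqI[of _ _ ?c]) auto
  qed
  moreover have "finite_mod ?C ((range d' + range d'') \<inter> A p q)"
  proof (rule finite_mod_mono[OF finite_mod_image[OF linear_component d] order_refl])
    have "component p q (?D y) \<in> (range d' + range d'') \<inter> A p q" for y
      using component_A[of p q "?D y"] unfolding component_total_d by (intro IntI set_plus_intro rangeI)
    then show "component p q ` ?D ` total_part scale A (k - 2) \<subseteq> (range d' + range d'') \<inter> A p q"
      by blast
  qed
  moreover have "finite_mod ?K (?X1 \<inter> ?X2)"
  proof -
    have subK: "subspace ?K" using subspaces(4) by (intro subspace_inter subspace_A) simp
    have 1: "finite_mod ?K (?K \<inter> ?X1)" by (rule finite_mod_Int[OF subK subX1 K1])
    have "finite_mod (?K \<inter> ?X1) ?X2" by (rule finite_mod_mono[OF K2 _ order_refl]) blast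
    then have "finite_mod (?K \<inter> ?X1) (?K \<inter> ?X1 \<inter> ?X2)"
      by (rule finite_mod_Int[OF subspace_inter[OF subK subX1] subX2])
    with 1 have "finite_mod ?K (?K \<inter> ?X1 \<inter> ?X2)" by (rule finite_mod_trans)
    then show ?thesis by (rule finite_mod_mono[OF _ order_refl]) blast
  qed
  ultimately have "finite_mod ?K ((range d' + range d'') \<inter> A p q)"
    by (meson finite_mod_mono finite_mod_trans order_refl)
  then show ?thesis by simp
qed

section \<open>The equivalences\<close>

lemma boundaries_subset:
  "range (d' \<circ> d'') \<inter> A p q \<subseteq> {x. d' x = 0} \<inter> {x. d'' x = 0} \<inter> A p q"
  "d' ` A (p - 1) q \<subseteq> {x. d' x = 0} \<inter> A p q"
  "(range d' + range d'') \<inter> A p q \<subseteq> {x. (d' \<circ> d'') x = 0} \<inter> A p q"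
  "total_d d' d'' ` total_part scale A (k - 1) \<subseteq> {x. total_d d' d'' x = 0} \<inter> total_part scale A k"
  "range (d' \<circ> d'') \<inter> total_part scale A k \<subseteq> {x. d' x = 0} \<inter> {x. d'' x = 0} \<inter> total_part scale A k"
  "(range d' + range d'') \<inter> total_part scale A k \<subseteq> {x. (d' \<circ> d'') x = 0} \<inter> total_part scale A k"
proof -
  have 1: "range (d' \<circ> d'') \<subseteq> {x. d' x = 0} \<inter> {x. d'' x = 0}" by auto
  have 2: "range d' + range d'' \<subseteq> {x. (d' \<circ> d'') x = 0}" by (auto elim!: set_plus_elim)
  show "range (d' \<circ> d'') \<inter> A p q \<subseteq> {x. d' x = 0} \<inter> {x. d'' x = 0} \<inter> A p q"
    "range (d' \<circ> d'') \<inter> total_part scale A k \<subseteq> {x. d' x = 0} \<inter> {x. d'' x = 0} \<inter> total_part scale A k"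
    using 1 by blast+
  show "(range d' + range d'') \<inter> A p q \<subseteq> {x. (d' \<circ> d'') x = 0} \<inter> A p q"
    "(range d' + range d'') \<inter> total_part scale A k \<subseteq> {x. (d' \<circ> d'') x = 0} \<inter> total_part scale A k"
    using 2 by blast+
  show "d' ` A (p - 1) q \<subseteq> {x. d' x = 0} \<inter> A p q" unfolding range_d'_A[symmetric] by auto
  show "total_d d' d'' ` total_part scale A (k - 1) \<subseteq> {x. total_d d' d'' x = 0} \<inter> total_part scale A k"
    using total_d_total_part[of _ "k - 1" k] by auto
qed

text \<open>Together with \<open>exact_subset\<close>, the inclusions that let the identity induce
  the comparison maps; they discharge the side conditions of \<open>qdim_eqI\<close>,
  \<open>surj_imp_inj\<close> and \<open>inj_imp_surj\<close>.\<close>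

lemma closed_subset:
  "{x. d' x = 0} \<inter> {x. d'' x = 0} \<inter> A p q \<subseteq> {x. d' x = 0} \<inter> A p q"
  "{x. d' x = 0} \<inter> A p q \<subseteq> {x. (d' \<circ> d'') x = 0} \<inter> A p q"
  "{x. d' x = 0} \<inter> {x. d'' x = 0} \<inter> total_part scale A k \<subseteq> {x. total_d d' d'' x = 0} \<inter> total_part scale A k"
  "{x. total_d d' d'' x = 0} \<inter> total_part scale A k \<subseteq> {x. (d' \<circ> d'') x = 0} \<inter> total_part scale A k"
proof -
  show "{x. d' x = 0} \<inter> A p q \<subseteq> {x. (d' \<circ> d'') x = 0} \<inter> A p q"
  proof
    show "x \<in> {x. (d' \<circ> d'') x = 0} \<inter> A p q" if "x \<in> {x. d' x = 0} \<inter> A p q" for x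
      using that d''_d'[of x] by simp
  qed
qed (use kernel_sub in blast)+

lemma exact_subset:
  "range (d' \<circ> d'') \<inter> A p q \<subseteq> d' ` A (p - 1) q"
  "d' ` A (p - 1) q \<subseteq> (range d' + range d'') \<inter> A p q"
  "range (d' \<circ> d'') \<inter> total_part scale A k \<subseteq> total_d d' d'' ` total_part scale A (k - 1)"
  "total_d d' d'' ` total_part scale A (k - 1) \<subseteq> (range d' + range d'') \<inter> total_part scale A k"
proof -
  show "range (d' \<circ> d'') \<inter> A p q \<subseteq> d' ` A (p - 1) q" unfolding range_d'_A[symmetric] by auto
  have "range d' \<subseteq> range d' + range d''"
    using set_zero_plus2[OF subspace_0[OF subspace_range_d''], of "range d'"] by (simp only: add.commute)
  then show "d' ` A (p - 1) q \<subseteq> (range d' + range d'') \<inter> A p q" unfolding range_d'_A[symmetric] by blast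
  show "range (d' \<circ> d'') \<inter> total_part scale A k \<subseteq> total_d d' d'' ` total_part scale A (k - 1)"
  proof
    fix x assume "x \<in> range (d' \<circ> d'') \<inter> total_part scale A k"
    then obtain y where y: "y \<in> total_part scale A (k - 2)" "x = d' (d'' y)"
      using range_d'_d''_total_part by blast
    have "x = total_d d' d'' (d'' y)" by (simp add: y(2) total_d_def)
    then show "x \<in> total_d d' d'' ` total_part scale A (k - 1)"
      using d''_total_part[OF y(1), of "k - 1"] by simp
  qed
  show "total_d d' d'' ` total_part scale A (k - 1) \<subseteq> (range d' + range d'') \<inter> total_part scale A k"
  proof (intro image_subsetI IntI)
    show "total_d d' d'' x \<in> range d' + range d''" for x
      unfolding total_d_def by (intro set_plus_intro rangeI)
    show "total_d d' d'' x \<in> total_part scale A k" if "x \<in> total_part scale A (k - 1)" for x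
      using that by (rule total_d_total_part) simp
  qed
qed

lemma h_swap:
  "h_BC scale (\<lambda>p q. A q p) d'' d' q p = h_BC scale A d' d'' p q"
  "h_A scale (\<lambda>p q. A q p) d'' d' q p = h_A scale A d' d'' p q"
  "h_d' scale (\<lambda>p q. A q p) d'' q p = h_d'' scale A d'' p q"
  "betti scale (\<lambda>p q. A q p) d'' d' k = betti scale A d' d'' k"
proof -
  have "{x. d'' x = 0} \<inter> {x. d' x = 0} = {x. d' x = 0} \<inter> {x. d'' x = 0}" by blast
  then show "h_BC scale (\<lambda>p q. A q p) d'' d' q p = h_BC scale A d' d'' p q"
    by (simp only: h_BC_def H_BC_def range_d''_d')
  have "{x. (d'' \<circ> d') x = 0} = {x. (d' \<circ> d'') x = 0}" by simp
  then show "h_A scale (\<lambda>p q. A q p) d'' d' q p = h_A scale A d' d'' p q"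
    by (simp only: h_A_def H_A_def add.commute)
  show "h_d' scale (\<lambda>p q. A q p) d'' q p = h_d'' scale A d'' p q"
    by (simp only: h_d'_def H_d'_def h_d''_def H_d''_def)
  show "betti scale (\<lambda>p q. A q p) d'' d' k = betti scale A d' d'' k"
    by (simp only: betti_def H_d_def total_d_swap total_part_swap)
qed

lemma h_finite_iff:
  "h_BC scale A d' d'' p q < \<infinity> \<longleftrightarrow>
    finite_mod ({x. d' x = 0} \<inter> {x. d'' x = 0} \<inter> A p q) (range (d' \<circ> d'') \<inter> A p q)"
  "h_d' scale A d' p q < \<infinity> \<longleftrightarrow> finite_mod ({x. d' x = 0} \<inter> A p q) (d' ` A (p - 1) q)"
  "h_A scale A d' d'' p q < \<infinity> \<longleftrightarrow>
    finite_mod ({x. (d' \<circ> d'') x = 0} \<inter> A p q) ((range d' + range d'') \<inter> A p q)"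
  "betti scale A d' d'' k < \<infinity> \<longleftrightarrow>
    finite_mod ({x. total_d d' d'' x = 0} \<inter> total_part scale A k) (total_d d' d'' ` total_part scale A (k - 1))"
  unfolding h_BC_def H_BC_def h_d'_def H_d'_def h_A_def H_A_def betti_def H_d_def enat_ord_simps(4)
  by (intro qdim_finite_iff subspaces boundaries_subset)+

lemma h_d''_finite_iff:
  "h_d'' scale A d'' p q < \<infinity> \<longleftrightarrow> finite_mod ({x. d'' x = 0} \<inter> A p q) (d'' ` A p (q - 1))"
proof -
  interpret swap: bounded_double_complex scale "\<lambda>p q. A q p" d'' d'
    by (rule bounded_double_complex_swap)
  show ?thesis using swap.h_finite_iff(2)[of q p] by (simp only: h_swap)
qed

text \<open>Bott--Chern and Aeppli cohomology are routed through \<open>H_d'\<close>;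
  \<open>H_d''\<close> is the \<open>H_d'\<close> of the interchanged complex, whose total
  cohomology is the same.\<close>

lemma betti_finite:
  assumes "(\<forall>p q. h_BC scale A d' d'' p q < \<infinity>) \<or> (\<forall>p q. h_A scale A d' d'' p q < \<infinity>) \<or>
      (\<forall>p q. h_d' scale A d' p q < \<infinity>) \<or> (\<forall>p q. h_d'' scale A d'' p q < \<infinity>) \<or>
      (\<forall>k. betti scale A d' d'' k < \<infinity>)"
  shows "betti scale A d' d'' k < \<infinity>"
proof -
  interpret swap: bounded_double_complex scale "\<lambda>p q. A q p" d'' d'
    by (rule bounded_double_complex_swap)
  have 1: "betti scale A d' d'' k < \<infinity>" if "\<forall>p q. h_d' scale A d' p q < \<infinity>"
    using finite_d_of_d' that unfolding h_finite_iff by blast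
  have "betti scale A d' d'' k < \<infinity>" if "\<forall>p q. h_d'' scale A d'' p q < \<infinity>"
    using swap.finite_d_of_d'[of k] that unfolding swap.h_finite_iff[symmetric] h_swap by blast
  moreover have "\<forall>p q. h_d' scale A d' p q < \<infinity>" if "\<forall>p q. h_BC scale A d' d'' p q < \<infinity>"
    using finite_d'_of_BC that unfolding h_finite_iff by blast
  moreover have "\<forall>p q. h_d' scale A d' p q < \<infinity>" if "\<forall>p q. h_A scale A d' d'' p q < \<infinity>"
    using finite_d'_of_A that unfolding h_finite_iff by blast
  ultimately show ?thesis using 1 assms by blast
qed

lemma h_BC_eq_h_d':
  assumes "dd_half (\<lambda>p q. A q p) d'' d' (q + 1) p" "dd_half A d' d'' p q"
  shows "h_BC scale A d' d'' p q = h_d' scale A d' p q"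
  unfolding h_BC_def H_BC_def h_d'_def H_d'_def
  by (rule qdim_eqI)
    (intro subspaces exact_subset boundaries_subset closed_subset BC_to_d'_surj[OF assms(1)]
      BC_to_d'_inj_iff[THEN iffD2, OF assms(2)])+

text \<open>The half for \<open>d''\<close> at \<open>(p, q + 1)\<close> yields the half for
  \<open>d'\<close> at \<open>(p, q)\<close>. The interchanged statement exchanges the roles, so the
  two halves feed each other as the degree drops.\<close>

lemma dd_half_of_h_BC:
  assumes "dd_half (\<lambda>p q. A q p) d'' d' (q + 1) p"
    and "h_BC scale A d' d'' p q = h_d' scale A d' p q" "h_d' scale A d' p q < \<infinity>"
  shows "dd_half A d' d'' p q"
  unfolding BC_to_d'_inj_iff[symmetric]
  by (rule surj_imp_inj[OF _ _ _ _ _ _ _ _ BC_to_d'_surj[OF assms(1)]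
        assms(2,3)[unfolded h_BC_def H_BC_def h_d'_def H_d'_def enat_ord_simps(4)]])
    (intro subspaces exact_subset boundaries_subset closed_subset)+

lemma h_A_eq_h_d':
  assumes "dd_half (\<lambda>p q. A q p) d'' d' q p" "dd_half A d' d'' (p + 1) q"
  shows "h_A scale A d' d'' p q = h_d' scale A d' p q"
  unfolding h_A_def H_A_def h_d'_def H_d'_def
  by (rule qdim_eqI[symmetric])
    (intro subspaces exact_subset boundaries_subset closed_subset d'_to_A_inj[OF assms(1)]
      d'_to_A_surj_iff[THEN iffD2, OF assms(2)])+

text \<open>Here the half for \<open>d''\<close> at \<open>(p, q)\<close> yields the half for
  \<open>d'\<close> at \<open>(p + 1, q)\<close>, so the exchange moves upwards.\<close>

lemma dd_half_of_h_A:
  assumes "dd_half (\<lambda>p q. A q p) d'' d' q p"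
    and "h_A scale A d' d'' p q = h_d' scale A d' p q" "h_d' scale A d' p q < \<infinity>"
  shows "dd_half A d' d'' (p + 1) q"
  unfolding d'_to_A_surj_iff[symmetric]
  by (rule inj_imp_surj[OF _ _ _ _ _ _ _ _ d'_to_A_inj[OF assms(1)]
        assms(2)[symmetric, unfolded h_A_def H_A_def h_d'_def H_d'_def]
        assms(3)[unfolded h_d'_def H_d'_def enat_ord_simps(4)]])
    (intro subspaces exact_subset boundaries_subset closed_subset)+

lemma total_h_BC_eq_betti:
  assumes "\<forall>p q. p + q = k + 1 \<longrightarrow> dd_lemma_at A d' d'' p q" "\<forall>p q. p + q = k \<longrightarrow> dd_lemma_at A d' d'' p q"
  shows "total_dim (h_BC scale A d' d'') k = betti scale A d' d'' k"
  unfolding total_dim_h_BC betti_def H_d_def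
  by (rule qdim_eqI)
    (intro subspaces exact_subset boundaries_subset closed_subset BC_to_d_surj[OF assms(1)]
      BC_to_d_inj[OF assms(2)])+

lemma total_h_A_eq_betti:
  assumes "\<forall>p q. p + q = k \<longrightarrow> dd_lemma_at A d' d'' p q" "\<forall>p q. p + q = k + 1 \<longrightarrow> dd_lemma_at A d' d'' p q"
  shows "total_dim (h_A scale A d' d'') k = betti scale A d' d'' k"
  unfolding total_dim_h_A betti_def H_d_def
  by (rule qdim_eqI[symmetric])
    (intro subspaces exact_subset boundaries_subset closed_subset d_to_A_inj[OF assms(1)]
      d_to_A_surj[OF assms(2)])+

text \<open>Injectivity in total degree is a statement symmetric in \<open>d'\<close> and
  \<open>d''\<close>, so it returns both halves at once.\<close>

lemma dd_lemma_at_of_total_h_BC: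
  assumes dd: "\<forall>p q. p + q = k + 1 \<longrightarrow> dd_lemma_at A d' d'' p q"
    and eq: "total_dim (h_BC scale A d' d'') k = betti scale A d' d'' k" and fin: "betti scale A d' d'' k < \<infinity>"
    and pq: "p + q = k"
  shows "dd_lemma_at A d' d'' p q"
proof -
  interpret swap: bounded_double_complex scale "\<lambda>p q. A q p" d'' d'
    by (rule bounded_double_complex_swap)
  have inj: "{x. d' x = 0} \<inter> {x. d'' x = 0} \<inter> total_part scale A k \<inter> total_d d' d'' ` total_part scale A (k - 1)
    \<subseteq> range (d' \<circ> d'') \<inter> total_part scale A k"
    by (rule surj_imp_inj[OF _ _ _ _ _ _ _ _ BC_to_d_surj[OF dd] eq[unfolded total_dim_h_BC betti_def H_d_def]
          fin[unfolded betti_def H_d_def enat_ord_simps(4)]])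
      (intro subspaces exact_subset boundaries_subset closed_subset)+
  then have "{x. d'' x = 0} \<inter> {x. d' x = 0} \<inter> total_part scale A k \<inter> total_d d' d'' ` total_part scale A (k - 1)
    \<subseteq> range (d' \<circ> d'') \<inter> total_part scale A k" by blast
  then have "dd_half (\<lambda>p q. A q p) d'' d' q p"
    using swap.BC_to_d_injD[of k q p] pq unfolding total_part_swap total_d_swap range_d''_d' by linarith
  then show ?thesis using BC_to_d_injD[OF inj pq] by (simp only: dd_lemma_at_iff)
qed

lemma dd_lemma_at_of_total_h_A:
  assumes dd: "\<forall>p q. p + q = k \<longrightarrow> dd_lemma_at A d' d'' p q"
    and eq: "total_dim (h_A scale A d' d'') k = betti scale A d' d'' k" and fin: "betti scale A d' d'' k < \<infinity>"
    and pq: "p + q = k + 1"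
  shows "dd_lemma_at A d' d'' p q"
proof -
  interpret swap: bounded_double_complex scale "\<lambda>p q. A q p" d'' d'
    by (rule bounded_double_complex_swap)
  note swap.d''_d' [simp del]
  have surj: "{x. (d' \<circ> d'') x = 0} \<inter> total_part scale A k \<subseteq>
      {x. total_d d' d'' x = 0} \<inter> total_part scale A k + (range d' + range d'') \<inter> total_part scale A k"
    by (rule inj_imp_surj[OF _ _ _ _ _ _ _ _ d_to_A_inj[OF dd] eq[symmetric, unfolded total_dim_h_A betti_def H_d_def]
          fin[unfolded betti_def H_d_def enat_ord_simps(4)]])
      (intro subspaces exact_subset boundaries_subset closed_subset)+
  have *: "{x. (d'' \<circ> d') x = 0} = {x. (d' \<circ> d'') x = 0}" by simp
  have "dd_half (\<lambda>p q. A q p) d'' d' q p"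
    by (rule swap.d_to_A_surjD[of k], unfold total_part_swap total_d_swap * add.commute[of "range d''"])
      (rule surj, use pq in linarith)
  then show ?thesis using d_to_A_surjD[OF surj pq] by (simp only: dd_lemma_at_iff)
qed

section \<open>Induction on the total degree\<close>

lemma degree_bound: obtains M where "\<And>p q. M < \<bar>p + q\<bar> \<Longrightarrow> A p q = {0}"
proof -
  let ?S = "(\<lambda>(p, q). \<bar>p + q\<bar>) ` {(p, q). A p q \<noteq> {0}}"
  have fin: "finite ?S" using bounded by (simp add: totally_bounded_complex_def)
  have "A p q = {0}" if "Max (insert 0 ?S) < \<bar>p + q\<bar>" for p q
  proof (rule ccontr)
    assume "A p q \<noteq> {0}"
    then have "\<bar>p + q\<bar> \<in> insert 0 ?S" by force
    then have "\<bar>p + q\<bar> \<le> Max (insert 0 ?S)" using fin by (intro Max_ge) auto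
    then show False using that by simp
  qed
  then show ?thesis by (rule that)
qed

lemma dd_lemma_at_trivial: "A p q = {0} \<Longrightarrow> dd_lemma_at A d' d'' p q"
  unfolding dd_lemma_at_iff dd_half_def
  using subspace_0[OF subspace_range_d'_d''] by (auto simp only: range_d''_d')

lemma degree_induct_up:
  assumes base: "\<And>p q. A p q = {0} \<Longrightarrow> P p q"
    and step: "\<And>k. \<forall>p q. p + q = k \<longrightarrow> P p q \<Longrightarrow> \<forall>p q. p + q = k + 1 \<longrightarrow> P p q"
  shows "P p q"
proof -
  obtain M where M: "\<And>p q. M < \<bar>p + q\<bar> \<Longrightarrow> A p q = {0}" by (rule degree_bound) (rule that)
  \<comment> \<open>Every \<open>k \<le> L\<close> satisfies
    \<open>\<bar>M\<bar> < \<bar>k\<bar>\<close>, whatever the sign of \<open>M\<close>.\<close>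
  define L where "L = - \<bar>M\<bar> - 1"
  have low: "\<forall>p q. p + q = k \<longrightarrow> P p q" if "k \<le> L" for k
    using base M that unfolding L_def by fastforce
  have "\<forall>p q. p + q = k \<longrightarrow> P p q" if "k \<ge> L" for k
    using that by (induction rule: int_ge_induct) (use low step in blast)+
  then have "\<forall>p' q'. p' + q' = p + q \<longrightarrow> P p' q'" using low[of "p + q"] by (cases "p + q \<ge> L") auto
  then show ?thesis by blast
qed

lemma degree_induct_down:
  assumes base: "\<And>p q. A p q = {0} \<Longrightarrow> P p q"
    and step: "\<And>k. \<forall>p q. p + q = k + 1 \<longrightarrow> P p q \<Longrightarrow> \<forall>p q. p + q = k \<longrightarrow> P p q"
  shows "P p q"
proof -
  obtain M where M: "\<And>p q. M < \<bar>p + q\<bar> \<Longrightarrow> A p q = {0}" by (rule degree_bound) (rule that)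
  define L where "L = \<bar>M\<bar> + 1"
  have high: "\<forall>p q. p + q = k \<longrightarrow> P p q" if "k \<ge> L" for k
    using base M that unfolding L_def by fastforce
  have "\<forall>p q. p + q = k \<longrightarrow> P p q" if "k \<le> L" for k
    using that
  proof (induction rule: int_le_induct)
    case (step i)
    then show ?case using \<open>\<And>k. \<forall>p q. p + q = k + 1 \<longrightarrow> P p q \<Longrightarrow> \<forall>p q. p + q = k \<longrightarrow> P p q\<close>[of "i - 1"] by simp
  qed (use high in blast)
  then have "\<forall>p' q'. p' + q' = p + q \<longrightarrow> P p' q'" using high[of "p + q"] by (cases "p + q \<le> L") auto
  then show ?thesis by blast
qed

lemma h_zero_finite:
  assumes "A p q = {0}"
  shows "h_BC scale A d' d'' p q < \<infinity>" "h_A scale A d' d'' p q < \<infinity>"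
  unfolding h_finite_iff
  using assms boundaries_subset(1,3)[of p q] subspace_0[OF subspace_inter[OF subspace_range_d'_d'' subspace_A]]
    subspace_0[OF subspace_inter[OF subspace_set_plus[OF subspace_range_d' subspace_range_d''] subspace_A]]
  by (auto intro!: finite_mod_subset)

lemma h_BC_finite:
  assumes eq: "\<And>p q. h_BC scale A d' d'' p q = h_d' scale A d' p q \<and> h_d' scale A d' p q = h_d'' scale A d'' p q"
    and betti: "\<And>k. betti scale A d' d'' k < \<infinity>"
  shows "h_BC scale A d' d'' p q < \<infinity>"
proof (rule degree_induct_up)
  show "\<forall>p q. p + q = k + 1 \<longrightarrow> h_BC scale A d' d'' p q < \<infinity>" if "\<forall>p q. p + q = k \<longrightarrow> h_BC scale A d' d'' p q < \<infinity>" for k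
  proof (intro allI impI)
    fix p q :: int assume pq: "p + q = k + 1"
    have k: "k + 1 - 1 = k" by simp
    have "h_d' scale A d' p q < \<infinity>" "h_d'' scale A d'' p q < \<infinity>" if "p + q = k" for p q
      using eq[of p q] \<open>\<forall>p q. p + q = k \<longrightarrow> h_BC scale A d' d'' p q < \<infinity>\<close> that by metis+
    then show "h_BC scale A d' d'' p q < \<infinity>"
      using finite_BC_of_d_d'_d''[OF _ _ _ pq] betti[of "k + 1"] unfolding h_finite_iff h_d''_finite_iff k by blast
  qed
qed (rule h_zero_finite)

lemma h_A_finite:
  assumes eq: "\<And>p q. h_A scale A d' d'' p q = h_d' scale A d' p q \<and> h_d' scale A d' p q = h_d'' scale A d'' p q"
    and betti: "\<And>k. betti scale A d' d'' k < \<infinity>"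
  shows "h_A scale A d' d'' p q < \<infinity>"
proof (rule degree_induct_down)
  show "\<forall>p q. p + q = k \<longrightarrow> h_A scale A d' d'' p q < \<infinity>" if "\<forall>p q. p + q = k + 1 \<longrightarrow> h_A scale A d' d'' p q < \<infinity>" for k
  proof (intro allI impI)
    fix p q :: int assume pq: "p + q = k"
    have k: "k + 1 - 1 = k" "k + 1 - 2 = k - 1" by simp_all
    have "h_d' scale A d' p q < \<infinity>" "h_d'' scale A d'' p q < \<infinity>" if "p + q = k + 1" for p q
      using eq[of p q] \<open>\<forall>p q. p + q = k + 1 \<longrightarrow> h_A scale A d' d'' p q < \<infinity>\<close> that by metis+
    then show "h_A scale A d' d'' p q < \<infinity>"
      using finite_A_of_d_d'_d''[of "k + 1" p q] betti[of k] pq unfolding h_finite_iff h_d''_finite_iff k by blast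
  qed
qed (rule h_zero_finite)

section \<open>Numerical characterisations of the d'd''-lemma\<close>

lemma dd_lemma_imp_h:
  assumes "dd_lemma A d' d''"
  shows "h_BC scale A d' d'' p q = h_d' scale A d' p q" "h_BC scale A d' d'' p q = h_d'' scale A d'' p q"
    "h_A scale A d' d'' p q = h_d' scale A d' p q" "h_A scale A d' d'' p q = h_d'' scale A d'' p q"
proof -
  interpret swap: bounded_double_complex scale "\<lambda>p q. A q p" d'' d'
    by (rule bounded_double_complex_swap)
  have dd: "dd_half A d' d'' p q" "dd_half (\<lambda>p q. A q p) d'' d' q p" for p q
    using assms by (auto simp only: dd_lemma_def dd_lemma_at_iff)
  show "h_BC scale A d' d'' p q = h_d' scale A d' p q" "h_A scale A d' d'' p q = h_d' scale A d' p q"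
    by (intro h_BC_eq_h_d' h_A_eq_h_d' dd)+
  show "h_BC scale A d' d'' p q = h_d'' scale A d'' p q" "h_A scale A d' d'' p q = h_d'' scale A d'' p q"
    by (rule swap.h_BC_eq_h_d'[unfolded h_swap, OF dd], rule swap.h_A_eq_h_d'[unfolded h_swap, OF dd])
qed

lemma dd_lemma_iff_h_BC:
  assumes betti: "\<And>k. betti scale A d' d'' k < \<infinity>"
  shows "dd_lemma A d' d'' \<longleftrightarrow> (\<forall>p q. h_BC scale A d' d'' p q = h_d' scale A d' p q \<and>
      h_d' scale A d' p q = h_d'' scale A d'' p q)"
proof
  assume "dd_lemma A d' d''"
  from dd_lemma_imp_h(1,2)[OF this]
  show "\<forall>p q. h_BC scale A d' d'' p q = h_d' scale A d' p q \<and> h_d' scale A d' p q = h_d'' scale A d'' p q"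
    by metis
next
  assume eq: "\<forall>p q. h_BC scale A d' d'' p q = h_d' scale A d' p q \<and> h_d' scale A d' p q = h_d'' scale A d'' p q"
  interpret swap: bounded_double_complex scale "\<lambda>p q. A q p" d'' d'
    by (rule bounded_double_complex_swap)
  have fin: "h_d' scale A d' p q < \<infinity>" "h_d'' scale A d'' p q < \<infinity>" for p q
    using h_BC_finite[of p q] eq betti by metis+
  have "dd_lemma_at A d' d'' p q" for p q
  proof (rule degree_induct_down)
    show "\<forall>p q. p + q = k \<longrightarrow> dd_lemma_at A d' d'' p q"
      if dd: "\<forall>p q. p + q = k + 1 \<longrightarrow> dd_lemma_at A d' d'' p q" for k
    proof (intro allI impI)
      fix p q :: int assume pq: "p + q = k"
      \<comment> \<open>Both halves sit in degree \<open>k + 1\<close>, at \<open>(p, q + 1)\<close>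
        and \<open>(p + 1, q)\<close>; each gives the opposite half at
        \<open>(p, q)\<close>.\<close>
      have "dd_half (\<lambda>p q. A q p) d'' d' (q + 1) p" "dd_half A d' d'' (p + 1) q"
        using dd pq by (simp_all add: dd_lemma_at_iff)
      then show "dd_lemma_at A d' d'' p q"
        unfolding dd_lemma_at_iff
        using dd_half_of_h_BC[of q p] swap.dd_half_of_h_BC[of p q] fin[of p q] eq unfolding h_swap by metis
    qed
  qed (rule dd_lemma_at_trivial)
  then show "dd_lemma A d' d''" by (simp only: dd_lemma_def) blast
qed

lemma dd_lemma_iff_h_A:
  assumes betti: "\<And>k. betti scale A d' d'' k < \<infinity>"
  shows "dd_lemma A d' d'' \<longleftrightarrow> (\<forall>p q. h_A scale A d' d'' p q = h_d' scale A d' p q \<and>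
      h_d' scale A d' p q = h_d'' scale A d'' p q)"
proof
  assume "dd_lemma A d' d''"
  from dd_lemma_imp_h(3,4)[OF this]
  show "\<forall>p q. h_A scale A d' d'' p q = h_d' scale A d' p q \<and> h_d' scale A d' p q = h_d'' scale A d'' p q"
    by metis
next
  assume eq: "\<forall>p q. h_A scale A d' d'' p q = h_d' scale A d' p q \<and> h_d' scale A d' p q = h_d'' scale A d'' p q"
  interpret swap: bounded_double_complex scale "\<lambda>p q. A q p" d'' d'
    by (rule bounded_double_complex_swap)
  have fin: "h_d' scale A d' p q < \<infinity>" "h_d'' scale A d'' p q < \<infinity>" for p q
    using h_A_finite[of p q] eq betti by metis+
  have "dd_lemma_at A d' d'' p q" for p q
  proof (rule degree_induct_up)
    show "\<forall>p q. p + q = k + 1 \<longrightarrow> dd_lemma_at A d' d'' p q"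
      if dd: "\<forall>p q. p + q = k \<longrightarrow> dd_lemma_at A d' d'' p q" for k
    proof (intro allI impI)
      fix p q :: int assume pq: "p + q = k + 1"
      \<comment> \<open>The half for \<open>d''\<close> at \<open>(p - 1, q)\<close> gives the half
        for \<open>d'\<close> at \<open>(p, q)\<close>, and the half for \<open>d'\<close> at
        \<open>(p, q - 1)\<close> gives the half for \<open>d''\<close> there.\<close>
      have "dd_half (\<lambda>p q. A q p) d'' d' q (p - 1)" "dd_half A d' d'' p (q - 1)"
        using dd pq by (simp_all add: dd_lemma_at_iff)
      then have "dd_half A d' d'' (p - 1 + 1) q" "dd_half (\<lambda>p q. A q p) d'' d' (q - 1 + 1) p"
        using dd_half_of_h_A[of q "p - 1"] swap.dd_half_of_h_A[of p "q - 1"] fin eq unfolding h_swap by metis+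
      then show "dd_lemma_at A d' d'' p q" by (simp add: dd_lemma_at_iff)
    qed
  qed (rule dd_lemma_at_trivial)
  then show "dd_lemma A d' d''" by (simp only: dd_lemma_def) blast
qed

lemma dd_lemma_iff_total_h_BC:
  assumes betti: "\<And>k. betti scale A d' d'' k < \<infinity>"
  shows "dd_lemma A d' d'' \<longleftrightarrow> (\<forall>k. total_dim (h_BC scale A d' d'') k = betti scale A d' d'' k)"
proof
  assume "dd_lemma A d' d''"
  then show "\<forall>k. total_dim (h_BC scale A d' d'') k = betti scale A d' d'' k"
    unfolding dd_lemma_def by (intro allI total_h_BC_eq_betti) blast+
next
  assume eq: "\<forall>k. total_dim (h_BC scale A d' d'') k = betti scale A d' d'' k"
  have "dd_lemma_at A d' d'' p q" for p q
  proof (rule degree_induct_down[OF dd_lemma_at_trivial])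
    show "\<forall>p q. p + q = k \<longrightarrow> dd_lemma_at A d' d'' p q"
      if "\<forall>p q. p + q = k + 1 \<longrightarrow> dd_lemma_at A d' d'' p q" for k
      using dd_lemma_at_of_total_h_BC[OF that eq[rule_format] betti] by (intro allI impI)
  qed
  then show "dd_lemma A d' d''" by (simp only: dd_lemma_def) blast
qed

lemma dd_lemma_iff_total_h_A:
  assumes betti: "\<And>k. betti scale A d' d'' k < \<infinity>"
  shows "dd_lemma A d' d'' \<longleftrightarrow> (\<forall>k. total_dim (h_A scale A d' d'') k = betti scale A d' d'' k)"
proof
  assume "dd_lemma A d' d''"
  then show "\<forall>k. total_dim (h_A scale A d' d'') k = betti scale A d' d'' k"
    unfolding dd_lemma_def by (intro allI total_h_A_eq_betti) blast+
next
  assume eq: "\<forall>k. total_dim (h_A scale A d' d'') k = betti scale A d' d'' k"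
  have "dd_lemma_at A d' d'' p q" for p q
  proof (rule degree_induct_up[OF dd_lemma_at_trivial])
    show "\<forall>p q. p + q = k + 1 \<longrightarrow> dd_lemma_at A d' d'' p q"
      if "\<forall>p q. p + q = k \<longrightarrow> dd_lemma_at A d' d'' p q" for k
      using dd_lemma_at_of_total_h_A[OF that eq[rule_format] betti] by (intro allI impI)
  qed
  then show "dd_lemma A d' d''" by (simp only: dd_lemma_def) blast
qed

end

theorem theorem3p9:
  fixes scale :: "complex \<Rightarrow> 'a::ab_group_add \<Rightarrow> 'a"
    and A :: "int \<Rightarrow> int \<Rightarrow> 'a set"
    and d' d'' :: "'a \<Rightarrow> 'a"
  assumes "double_complex scale A d' d''"
    and "totally_bounded_complex A"
    and "(\<forall>p q. h_BC scale A d' d'' p q < \<infinity>) \<or>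
      (\<forall>p q. h_A scale A d' d'' p q < \<infinity>) \<or>
      (\<forall>p q. h_d' scale A d' p q < \<infinity>) \<or>
      (\<forall>p q. h_d'' scale A d'' p q < \<infinity>) \<or>
      (\<forall>k. betti scale A d' d'' k < \<infinity>)"
  shows "(dd_lemma A d' d'' \<longleftrightarrow>
      (\<forall>p q. h_BC scale A d' d'' p q = h_d' scale A d' p q \<and>
        h_d' scale A d' p q = h_d'' scale A d'' p q))
    \<and> (dd_lemma A d' d'' \<longleftrightarrow>
      (\<forall>p q. h_A scale A d' d'' p q = h_d' scale A d' p q \<and>
        h_d' scale A d' p q = h_d'' scale A d'' p q))
    \<and> (dd_lemma A d' d'' \<longleftrightarrow>
      (\<forall>k. total_dim (h_BC scale A d' d'') k = betti scale A d' d'' k))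
    \<and> (dd_lemma A d' d'' \<longleftrightarrow>
      (\<forall>k. total_dim (h_A scale A d' d'') k = betti scale A d' d'' k))"
proof -
  interpret bounded_double_complex scale A d' d''
    using assms(1,2) by (simp add: bounded_double_complex_def bounded_double_complex_axioms_def)
  note betti = betti_finite[OF assms(3)]
  show ?thesis
    using dd_lemma_iff_h_BC[OF betti] dd_lemma_iff_h_A[OF betti]
      dd_lemma_iff_total_h_BC[OF betti] dd_lemma_iff_total_h_A[OF betti] by blast
qed

end
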